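(* The category $\mathrm{Mod}_{\mathcal H}$ of $\mathcal H$-modules is noetherian; that is, every submodule of a finitely generated $\mathcal H$-module is finitely generated.
   Context: Fix a field $\mathbf k$. For $n\ge 0$ let $[n]=\{1,\dots,n\}$, and let $H_n(0)$ be the unital associative $\mathbf k$-algebra generated by $\pi_1,\dots,\pi_{n-1}$ with relations $\pi_i^2=\pi_i$, $\pi_i\pi_{i+1}\pi_i=\pi_{i+1}\pi_i\pi_{i+1}$, and $\pi_i\pi_j=\pi_j\pi_i$ for $|i-j|>1$. For $w\in\mathfrak S_n$ with reduced expression $w=s_{i_1}\cdots s_{i_r}$ in the adjacent transpositions $s_i=(i,i+1)$, put $\pi_w=\pi_{i_1}\cdots\pi_{i_r}$; the $\pi_w$ form a basis of $H_n(0)$ and a monoid $\mathcal M_n$ under multiplication. For $n\le m$, $\mathcal M_n\subseteq\mathcal M_m$ via $\pi_i\mapsto\pi_i$. The $0$-Hecke category $\mathcal H$ has objects $[n]$, $n\ge0$. For $n\le m$, $\mathrm{Hom}_{\mathcal H}([n],[m])$ is the set of braid diagrams from $n$ top vertices to $m$ bottom vertices with only positive crossings, modulo $\pi_i^2=\pi_i$, composed by padding with dummy strands, multiplying in the $0$-Hecke monoid and deleting dummy strands; there are no morphisms if $n>m$. Algebraically, $\mathrm{Hom}_{\mathcal H}([n],[m])$ is the quotient of $\mathcal M_m$ by the equivalence relation generated by $x\sim x\pi_j$ for $n+1\le j\le m-1$, and the composite of the class of $y\in\mathcal M_\ell$ in $\mathrm{Hom}([m],[\ell])$ with the class of $x\in\mathcal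 M_m$ in $\mathrm{Hom}([n],[m])$ is the class of $yx\in\mathcal M_\ell$. An $\mathcal H$-module is a functor from $\mathcal H$ to $\mathbf k$-vector spaces; it is finitely generated if finitely many elements are contained in no proper submodule. *)

theory Defs
  imports "HOL-Algebra.QuotRing" "HOL-Algebra.Module" "HOL-Combinatorics.Permutations"
begin

section \<open>Free algebras\<close>

text \<open>
  The free unital associative algebra over \<open>K\<close> on an alphabet \<open>A\<close>: finitely supported
  \<open>K\<close>-valued functions on words over \<open>A\<close>, multiplied by convolution along the splittings
  of a word.  Scalars act through multiples of the word \<open>[]\<close>, so a two-sided ring ideal is
  the same thing as a two-sided algebra ideal.
\<close>

definition word_conv :: "('k, 'r) ring_scheme \<Rightarrow> ('a list \<Rightarrow> 'k) \<Rightarrow> ('a list \<Rightarrow> 'k) \<Rightarrow> 'a list \<Rightarrow> 'k" where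
  "word_conv K f g = (\<lambda>w. \<Oplus>\<^bsub>K\<^esub>i\<in>{..length w}. f (take i w) \<otimes>\<^bsub>K\<^esub> g (drop i w))"

definition word_monom :: "('k, 'r) ring_scheme \<Rightarrow> 'a list \<Rightarrow> 'a list \<Rightarrow> 'k" where
  "word_monom K w = (\<lambda>u. if u = w then \<one>\<^bsub>K\<^esub> else \<zero>\<^bsub>K\<^esub>)"

definition free_algebra :: "('k, 'r) ring_scheme \<Rightarrow> 'a set \<Rightarrow> ('a list \<Rightarrow> 'k) ring" where
  "free_algebra K A =
    \<lparr>carrier = {f. (\<forall>w. f w \<in> carrier K) \<and> (\<forall>w. w \<notin> lists A \<longrightarrow> f w = \<zero>\<^bsub>K\<^esub>)
        \<and> finite {w. f w \<noteq> \<zero>\<^bsub>K\<^esub>}},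
     monoid.mult = word_conv K,
     one = word_monom K [],
     zero = (\<lambda>w. \<zero>\<^bsub>K\<^esub>),
     add = (\<lambda>f g w. f w \<oplus>\<^bsub>K\<^esub> g w)\<rparr>"

context ring
begin

lemma word_conv_closed:
  assumes "\<And>w. f w \<in> carrier R" "\<And>w. g w \<in> carrier R"
  shows "word_conv R f g w \<in> carrier R"
  using assms by (auto simp: word_conv_def intro!: finsum_closed)

lemma word_conv_Nil:
  assumes "\<And>w. f w \<in> carrier R" "\<And>w. g w \<in> carrier R"
  shows "word_conv R f g [] = f [] \<otimes> g []"
  using assms by (simp add: word_conv_def)

lemma word_conv_Cons:
  assumes "\<And>w. f w \<in> carrier R" "\<And>w. g w \<in> carrier R"
  shows "word_conv R f g (a # w) =
    f [] \<otimes> g (a # w) \<oplus> word_conv R (\<lambda>u. f (a # u)) g w"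
proof -
  have "word_conv R f g (a # w) =
      (\<Oplus>i\<in>{..Suc (length w)}. f (take i (a # w)) \<otimes> g (drop i (a # w)))"
    by (simp add: word_conv_def)
  also have "\<dots> = (\<Oplus>i\<in>{..length w}. f (a # take i w) \<otimes> g (drop i w)) \<oplus> f [] \<otimes> g (a # w)"
    using assms by (subst finsum_Suc2) auto
  also have "\<dots> = f [] \<otimes> g (a # w) \<oplus> word_conv R (\<lambda>u. f (a # u)) g w"
    using assms by (subst a_comm) (auto simp: word_conv_def intro!: finsum_closed)
  finally show ?thesis .
qed

lemma word_conv_l_distr:
  assumes "\<And>w. f w \<in> carrier R" "\<And>w. g w \<in> carrier R" "\<And>w. h w \<in> carrier R"
  shows "word_conv R (\<lambda>u. f u \<oplus> g u) h w = word_conv R f h w \<oplus> word_conv R g h w"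
proof -
  have "word_conv R (\<lambda>u. f u \<oplus> g u) h w =
      (\<Oplus>i\<in>{..length w}. f (take i w) \<otimes> h (drop i w) \<oplus> g (take i w) \<otimes> h (drop i w))"
    using assms by (auto simp: word_conv_def l_distr intro!: finsum_cong')
  also have "\<dots> = word_conv R f h w \<oplus> word_conv R g h w"
    unfolding word_conv_def using assms by (subst finsum_addf) auto
  finally show ?thesis .
qed

lemma word_conv_r_distr:
  assumes "\<And>w. f w \<in> carrier R" "\<And>w. g w \<in> carrier R" "\<And>w. h w \<in> carrier R"
  shows "word_conv R h (\<lambda>u. f u \<oplus> g u) w = word_conv R h f w \<oplus> word_conv R h g w"
proof -
  have "word_conv R h (\<lambda>u. f u \<oplus> g u) w =
      (\<Oplus>i\<in>{..length w}. h (take i w) \<otimes> f (drop i w) \<oplus> h (take i w) \<otimes> g (drop i w))"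
    using assms by (auto simp: word_conv_def r_distr intro!: finsum_cong')
  also have "\<dots> = word_conv R h f w \<oplus> word_conv R h g w"
    unfolding word_conv_def using assms by (subst finsum_addf) auto
  finally show ?thesis .
qed

lemma word_conv_smult:
  assumes "c \<in> carrier R" "\<And>w. f w \<in> carrier R" "\<And>w. g w \<in> carrier R"
  shows "word_conv R (\<lambda>u. c \<otimes> f u) g w = c \<otimes> word_conv R f g w"
proof -
  have "word_conv R (\<lambda>u. c \<otimes> f u) g w =
      (\<Oplus>i\<in>{..length w}. c \<otimes> (f (take i w) \<otimes> g (drop i w)))"
    using assms by (auto simp: word_conv_def m_assoc intro!: finsum_cong')
  also have "\<dots> = c \<otimes> word_conv R f g w"
    unfolding word_conv_def using assms by (subst finsum_rdistr) auto
  finally show ?thesis .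
qed

lemma word_conv_assoc:
  assumes "\<And>w. f w \<in> carrier R" "\<And>w. g w \<in> carrier R" "\<And>w. h w \<in> carrier R"
  shows "word_conv R (word_conv R f g) h w = word_conv R f (word_conv R g h) w"
  using assms
proof (induction w arbitrary: f g h)
  case Nil
  then show ?case by (simp add: word_conv_Nil word_conv_closed m_assoc)
next
  case (Cons a w)
  note c = Cons.prems
  have "word_conv R (word_conv R f g) h (a # w) =
      f [] \<otimes> g [] \<otimes> h (a # w) \<oplus>
      word_conv R (\<lambda>u. f [] \<otimes> g (a # u) \<oplus> word_conv R (\<lambda>u. f (a # u)) g u) h w"
    using c by (simp add: word_conv_Cons word_conv_Nil word_conv_closed)
  also have "\<dots> = f [] \<otimes> g [] \<otimes> h (a # w) \<oplus>
      (f [] \<otimes> word_conv R (\<lambda>u. g (a # u)) h w \<oplus>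
       word_conv R (\<lambda>u. f (a # u)) (word_conv R g h) w)"
    using c Cons.IH[of "\<lambda>u. f (a # u)" g h]
    by (simp add: word_conv_l_distr word_conv_smult word_conv_closed)
  also have "\<dots> = f [] \<otimes> (g [] \<otimes> h (a # w) \<oplus> word_conv R (\<lambda>u. g (a # u)) h w) \<oplus>
       word_conv R (\<lambda>u. f (a # u)) (word_conv R g h) w"
    using c by (simp add: word_conv_closed r_distr m_assoc a_assoc)
  also have "\<dots> = word_conv R f (word_conv R g h) (a # w)"
    using c by (simp add: word_conv_Cons word_conv_closed)
  finally show ?case .
qed

lemma word_conv_zero_l:
  assumes "\<And>w. g w \<in> carrier R"
  shows "word_conv R (\<lambda>u. \<zero>) g w = \<zero>"
  using assms by (simp add: word_conv_def)

lemma word_conv_one_l: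
  assumes "\<And>w. g w \<in> carrier R"
  shows "word_conv R (word_monom R []) g = g"
proof
  fix w
  have c: "word_monom R [] u \<in> carrier R" for u :: "'c list"
    by (simp add: word_monom_def)
  show "word_conv R (word_monom R []) g w = g w"
  proof (cases w)
    case Nil
    then show ?thesis
      using assms by (subst Nil, subst word_conv_Nil) (auto simp: c word_monom_def)
  next
    case (Cons a v)
    have z: "(\<lambda>u. word_monom R [] (a # u)) = (\<lambda>u. \<zero>)"
      by (auto simp: word_monom_def)
    show ?thesis
      unfolding Cons using assms
      by (subst word_conv_Cons) (auto simp: c z word_conv_zero_l, simp add: word_monom_def)
  qed
qed

lemma word_conv_one_r:
  assumes "\<And>w. f w \<in> carrier R"
  shows "word_conv R f (word_monom R []) w = f w"
  using assms
proof (induction w arbitrary: f)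
  case Nil
  then show ?case by (subst word_conv_Nil) (auto simp: word_monom_def)
next
  case (Cons a w)
  then show ?case
    by (subst word_conv_Cons) (auto simp: word_monom_def)
qed

lemma word_conv_support:
  assumes "\<And>w. f w \<in> carrier R" "\<And>w. g w \<in> carrier R" "word_conv R f g w \<noteq> \<zero>"
  shows "\<exists>u v. w = u @ v \<and> f u \<noteq> \<zero> \<and> g v \<noteq> \<zero>"
proof (rule ccontr)
  assume *: "\<not> ?thesis"
  have "f (take i w) \<otimes> g (drop i w) = \<zero>" for i
  proof -
    have "f (take i w) = \<zero> \<or> g (drop i w) = \<zero>"
      using * by (metis append_take_drop_id)
    then show ?thesis using assms(1,2) by auto
  qed
  then have "word_conv R f g w = \<zero>"
    by (simp add: word_conv_def)
  with assms(3) show False by simp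
qed

theorem free_algebra_ring: "ring (free_algebra R A)"
proof (rule ringI)
  show "abelian_group (free_algebra R A)"
  proof (rule abelian_groupI)
    fix f g
    assume f: "f \<in> carrier (free_algebra R A)" and g: "g \<in> carrier (free_algebra R A)"
    have "finite ({w. f w \<noteq> \<zero>} \<union> {w. g w \<noteq> \<zero>})"
      using f g by (auto simp: free_algebra_def)
    then have "finite {w. f w \<oplus> g w \<noteq> \<zero>}"
      by (rule rev_finite_subset) auto
    with f g show "f \<oplus>\<^bsub>free_algebra R A\<^esub> g \<in> carrier (free_algebra R A)"
      by (auto simp: free_algebra_def)
  next
    fix f
    assume f: "f \<in> carrier (free_algebra R A)"
    then have c: "f w \<in> carrier R" for w by (auto simp: free_algebra_def)
    have "{w. \<ominus> f w \<noteq> \<zero>} \<subseteq> {w. f w \<noteq> \<zero>}" by auto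
    then have "(\<lambda>w. \<ominus> f w) \<in> carrier (free_algebra R A)"
      using f by (auto simp: free_algebra_def intro: finite_subset)
    moreover have "(\<lambda>w. \<ominus> f w) \<oplus>\<^bsub>free_algebra R A\<^esub> f = \<zero>\<^bsub>free_algebra R A\<^esub>"
      by (simp add: free_algebra_def c l_neg)
    ultimately show "\<exists>g\<in>carrier (free_algebra R A). g \<oplus>\<^bsub>free_algebra R A\<^esub> f = \<zero>\<^bsub>free_algebra R A\<^esub>"
      by blast
  qed (auto simp: free_algebra_def a_assoc intro!: ext a_comm)
next
  show "monoid (free_algebra R A)"
  proof (rule monoidI)
    fix f g
    assume f: "f \<in> carrier (free_algebra R A)" and g: "g \<in> carrier (free_algebra R A)"
    then have cf: "f w \<in> carrier R" and cg: "g w \<in> carrier R" for w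
      by (auto simp: free_algebra_def)
    have sub: "{w. word_conv R f g w \<noteq> \<zero>} \<subseteq>
        (\<lambda>(u, v). u @ v) ` ({w. f w \<noteq> \<zero>} \<times> {w. g w \<noteq> \<zero>})"
      using word_conv_support[of f g] cf cg by (fastforce simp: image_iff)
    have "finite {w. word_conv R f g w \<noteq> \<zero>}"
      by (rule finite_subset[OF sub]) (use f g in \<open>auto simp: free_algebra_def\<close>)
    moreover have "word_conv R f g w = \<zero>" if "w \<notin> lists A" for w
    proof (rule ccontr)
      assume "word_conv R f g w \<noteq> \<zero>"
      then obtain u v where "w = u @ v" "f u \<noteq> \<zero>" "g v \<noteq> \<zero>"
        using word_conv_support[of f g] cf cg by blast
      with f g have "u \<in> lists A" "v \<in> lists A" by (auto simp: free_algebra_def)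
      with \<open>w = u @ v\<close> that show False by auto
    qed
    ultimately show "f \<otimes>\<^bsub>free_algebra R A\<^esub> g \<in> carrier (free_algebra R A)"
      using cf cg by (auto simp: free_algebra_def word_conv_closed)
  next
    have "finite {w. word_monom R [] w \<noteq> \<zero>}"
      by (rule finite_subset[of _ "{[]}"]) (auto simp: word_monom_def)
    then show "\<one>\<^bsub>free_algebra R A\<^esub> \<in> carrier (free_algebra R A)"
      by (auto simp: free_algebra_def word_monom_def split: if_splits)
  qed (auto simp: free_algebra_def word_conv_assoc word_conv_one_l word_conv_one_r)
qed (auto simp: free_algebra_def word_conv_l_distr word_conv_r_distr)

end


section \<open>The 0-Hecke algebra and the 0-Hecke monoid\<close>

abbreviation hecke_free :: "('k, 'r) ring_scheme \<Rightarrow> nat \<Rightarrow> (nat list \<Rightarrow> 'k) ring" where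
  "hecke_free K n \<equiv> free_algebra K {1..<n}"

definition hecke_relators :: "('k, 'r) ring_scheme \<Rightarrow> nat \<Rightarrow> (nat list \<Rightarrow> 'k) set" where
  "hecke_relators K n =
     {word_monom K [i, i] \<ominus>\<^bsub>hecke_free K n\<^esub> word_monom K [i] | i. i \<in> {1..<n}}
   \<union> {word_monom K [i, Suc i, i] \<ominus>\<^bsub>hecke_free K n\<^esub> word_monom K [Suc i, i, Suc i] | i.
        i \<in> {1..<n} \<and> Suc i \<in> {1..<n}}
   \<union> {word_monom K [i, j] \<ominus>\<^bsub>hecke_free K n\<^esub> word_monom K [j, i] | i j.
        i \<in> {1..<n} \<and> j \<in> {1..<n} \<and> \<bar>int i - int j\<bar> > 1}"

definition hecke_ideal :: "('k, 'r) ring_scheme \<Rightarrow> nat \<Rightarrow> (nat list \<Rightarrow> 'k) set" where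
  "hecke_ideal K n = Idl\<^bsub>hecke_free K n\<^esub> (hecke_relators K n)"

definition hecke_algebra :: "('k, 'r) ring_scheme \<Rightarrow> nat \<Rightarrow> (nat list \<Rightarrow> 'k) set ring" where
  "hecke_algebra K n = hecke_free K n Quot hecke_ideal K n"

lemma (in ring) word_monom_closed:
  assumes "w \<in> lists A"
  shows "word_monom R w \<in> carrier (free_algebra R A)"
proof -
  have "finite {u. word_monom R w u \<noteq> \<zero>}"
    by (rule finite_subset[of _ "{w}"]) (auto simp: word_monom_def)
  with assms show ?thesis
    by (auto simp: free_algebra_def word_monom_def split: if_splits)
qed

lemma (in ring) hecke_ideal_ideal: "ideal (hecke_ideal R n) (hecke_free R n)"
proof -
  interpret F: ring "hecke_free R n" by (rule free_algebra_ring)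
  show ?thesis
    unfolding hecke_ideal_def
    by (rule F.genideal_ideal)
      (auto simp: hecke_relators_def simp del: One_nat_def intro!: F.minus_closed word_monom_closed)
qed

theorem (in ring) hecke_algebra_ring: "ring (hecke_algebra R n)"
  unfolding hecke_algebra_def by (intro ideal.quotient_is_ring hecke_ideal_ideal)

text \<open>The product \<open>\<pi>\<^sub>i\<^sub>1 \<cdots> \<pi>\<^sub>i\<^sub>r\<close> for the word \<open>is = [i\<^sub>1, \<dots>, i\<^sub>r]\<close>.\<close>

definition hecke_word :: "('k, 'r) ring_scheme \<Rightarrow> nat \<Rightarrow> nat list \<Rightarrow> (nat list \<Rightarrow> 'k) set" where
  "hecke_word K n is = hecke_ideal K n +>\<^bsub>hecke_free K n\<^esub> word_monom K is"

definition word_perm :: "nat list \<Rightarrow> nat \<Rightarrow> nat" where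
  "word_perm is = foldr (\<lambda>i w. transpose i (Suc i) \<circ> w) is id"

definition reduced_expr :: "nat \<Rightarrow> (nat \<Rightarrow> nat) \<Rightarrow> nat list \<Rightarrow> bool" where
  "reduced_expr n w is \<longleftrightarrow> is \<in> lists {1..<n} \<and> word_perm is = w \<and>
     (\<forall>js \<in> lists {1..<n}. word_perm js = w \<longrightarrow> length is \<le> length js)"

text \<open>
  The set of all \<open>\<pi>\<^sub>w\<close>.  All reduced expressions of \<open>w\<close> are admitted; by Matsumoto's theorem
  they give the same element of the algebra.
\<close>

definition hecke_monoid :: "('k, 'r) ring_scheme \<Rightarrow> nat \<Rightarrow> (nat list \<Rightarrow> 'k) set set" where
  "hecke_monoid K n =
     {hecke_word K n is | w is. w permutes {1..n} \<and> reduced_expr n w is}"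

text \<open>
  The map of \<open>H\<^sub>n(0)\<close> to \<open>H\<^sub>m(0)\<close> given by \<open>\<pi>\<^sub>i \<mapsto> \<pi>\<^sub>i\<close>, for \<open>n \<le> m\<close>: the free algebra and the
  ideal for \<open>n\<close> are contained in those for \<open>m\<close>, so the union below is a single coset.
\<close>

definition hecke_incl ::
    "('k, 'r) ring_scheme \<Rightarrow> nat \<Rightarrow> (nat list \<Rightarrow> 'k) set \<Rightarrow> (nat list \<Rightarrow> 'k) set" where
  "hecke_incl K m x = (\<Union>a\<in>x. hecke_ideal K m +>\<^bsub>hecke_free K m\<^esub> a)"


section \<open>The 0-Hecke category\<close>

text \<open>The object \<open>[n]\<close> is represented by the number \<open>n\<close>.\<close>

inductive_set hecke_hom_equiv ::
    "('k, 'r) ring_scheme \<Rightarrow> nat \<Rightarrow> nat \<Rightarrow> ((nat list \<Rightarrow> 'k) set \<times> (nat list \<Rightarrow> 'k) set) set"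
  for K :: "('k, 'r) ring_scheme" and n m :: nat where
  gen: "x \<in> hecke_monoid K m \<Longrightarrow> j \<in> {n + 1..<m} \<Longrightarrow>
    (x, x \<otimes>\<^bsub>hecke_algebra K m\<^esub> hecke_word K m [j]) \<in> hecke_hom_equiv K n m"
| refl: "x \<in> hecke_monoid K m \<Longrightarrow> (x, x) \<in> hecke_hom_equiv K n m"
| sym: "(x, y) \<in> hecke_hom_equiv K n m \<Longrightarrow> (y, x) \<in> hecke_hom_equiv K n m"
| trans: "(x, y) \<in> hecke_hom_equiv K n m \<Longrightarrow> (y, z) \<in> hecke_hom_equiv K n m \<Longrightarrow>
    (x, z) \<in> hecke_hom_equiv K n m"

type_synonym 'k hecke_mor = "(nat list \<Rightarrow> 'k) set set"

definition hecke_hom :: "('k, 'r) ring_scheme \<Rightarrow> nat \<Rightarrow> nat \<Rightarrow> 'k hecke_mor set" where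
  "hecke_hom K n m = (if n \<le> m then hecke_monoid K m // hecke_hom_equiv K n m else {})"

definition hecke_id :: "('k, 'r) ring_scheme \<Rightarrow> nat \<Rightarrow> 'k hecke_mor" where
  "hecke_id K n = hecke_hom_equiv K n n `` {\<one>\<^bsub>hecke_algebra K n\<^esub>}"

text \<open>
  Composition \<open>[n] \<rightarrow> [m] \<rightarrow> [l]\<close>.  The class of \<open>y x\<close> does not depend on the
  representatives, so the union below is a single class.
\<close>

definition hecke_comp ::
    "('k, 'r) ring_scheme \<Rightarrow> nat \<Rightarrow> nat \<Rightarrow> 'k hecke_mor \<Rightarrow> 'k hecke_mor \<Rightarrow> 'k hecke_mor" where
  "hecke_comp K n l g f =
     (\<Union>y\<in>g. \<Union>x\<in>f. hecke_hom_equiv K n l `` {y \<otimes>\<^bsub>hecke_algebra K l\<^esub> hecke_incl K l x})"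


section \<open>Modules over the 0-Hecke category\<close>

definition linear_maps ::
    "('k, 'r) ring_scheme \<Rightarrow> ('k, 'v, 'p) module_scheme \<Rightarrow> ('k, 'w, 'q) module_scheme \<Rightarrow> ('v \<Rightarrow> 'w) set" where
  "linear_maps K M N = {h \<in> carrier M \<rightarrow> carrier N.
     (\<forall>x \<in> carrier M. \<forall>y \<in> carrier M. h (x \<oplus>\<^bsub>M\<^esub> y) = h x \<oplus>\<^bsub>N\<^esub> h y) \<and>
     (\<forall>c \<in> carrier K. \<forall>x \<in> carrier M. h (c \<odot>\<^bsub>M\<^esub> x) = c \<odot>\<^bsub>N\<^esub> h x)}"

text \<open>
  A functor to \<open>K\<close>-vector spaces: \<open>V n\<close> is the value at \<open>[n]\<close>, and \<open>act n m f\<close> is the linear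
  map induced by \<open>f : [n] \<rightarrow> [m]\<close>.
\<close>

definition hecke_module ::
    "('k, 'r) ring_scheme \<Rightarrow> (nat \<Rightarrow> ('k, 'v, 'p) module_scheme) \<Rightarrow>
     (nat \<Rightarrow> nat \<Rightarrow> 'k hecke_mor \<Rightarrow> 'v \<Rightarrow> 'v) \<Rightarrow> bool" where
  "hecke_module K V act \<longleftrightarrow>
     (\<forall>n. module K (V n)) \<and>
     (\<forall>n m. \<forall>f \<in> hecke_hom K n m. act n m f \<in> linear_maps K (V n) (V m)) \<and>
     (\<forall>n. \<forall>v \<in> carrier (V n). act n n (hecke_id K n) v = v) \<and>
     (\<forall>n m l. \<forall>f \<in> hecke_hom K n m. \<forall>g \<in> hecke_hom K m l. \<forall>v \<in> carrier (V n).
        act n l (hecke_comp K n l g f) v = act m l g (act n m f v))"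

definition hecke_submodule ::
    "('k, 'r) ring_scheme \<Rightarrow> (nat \<Rightarrow> ('k, 'v, 'p) module_scheme) \<Rightarrow>
     (nat \<Rightarrow> nat \<Rightarrow> 'k hecke_mor \<Rightarrow> 'v \<Rightarrow> 'v) \<Rightarrow> (nat \<Rightarrow> 'v set) \<Rightarrow> bool" where
  "hecke_submodule K V act N \<longleftrightarrow>
     (\<forall>n. submodule (N n) K (V n)) \<and>
     (\<forall>n m. \<forall>f \<in> hecke_hom K n m. \<forall>v \<in> N n. act n m f v \<in> N m)"

text \<open>An element of an \<open>\<H>\<close>-module is a pair of an object \<open>n\<close> and a vector in \<open>V n\<close>.\<close>

definition hecke_fin_gen ::
    "('k, 'r) ring_scheme \<Rightarrow> (nat \<Rightarrow> ('k, 'v, 'p) module_scheme) \<Rightarrow>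
     (nat \<Rightarrow> nat \<Rightarrow> 'k hecke_mor \<Rightarrow> 'v \<Rightarrow> 'v) \<Rightarrow> bool" where
  "hecke_fin_gen K V act \<longleftrightarrow>
     (\<exists>G. finite G \<and> G \<subseteq> (SIGMA n:UNIV. carrier (V n)) \<and>
        (\<forall>N. hecke_submodule K V act N \<and> (\<forall>(n, v) \<in> G. v \<in> N n) \<longrightarrow>
           (\<forall>n. N n = carrier (V n))))"

definition hecke_restrict ::
    "(nat \<Rightarrow> ('k, 'v, 'p) module_scheme) \<Rightarrow> (nat \<Rightarrow> 'v set) \<Rightarrow> nat \<Rightarrow> ('k, 'v, 'p) module_scheme" where
  "hecke_restrict V N = (\<lambda>n. (V n)\<lparr>carrier := N n\<rparr>)"

end

theory Submission
  imports Defs "HOL-Library.List_Lexorder"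
begin

text \<open>
  A morphism \<open>[n] \<rightarrow> [m]\<close> factors as an element of \<open>\<M>\<^sub>n\<close> followed by the positive braid lift of
  an order-preserving injection \<open>[n] \<rightarrow> [m]\<close>, the dummy strands of the lift being deletable.
  As \<open>\<M>\<^sub>n\<close> is finite, a finitely generated \<open>\<H>\<close>-module is finitely generated over the category
  of order-preserving injections, which is generated by the face maps.  Over the latter the
  Groebner argument applies: divisibility of order-preserving injections is the componentwise
  order on gap sequences, so Dickson's lemma bounds the leading terms of a submodule.  Only the
  relations of the 0-Hecke algebra are used, not the linear independence of the \<open>\<pi>\<^sub>w\<close>.
\<close>

section \<open>Words modulo the 0-Hecke relations\<close>

text \<open>A leading term argument for all morphisms at once breaks down because crossings merge
  injections: on one strand, \<open>\<pi>\<^sub>x\<close> sends \<open>[x]\<close> to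
  \<open>[Suc x]\<close> and also fixes \<open>[Suc x]\<close>, so a leading term may collide with a
  lower one. Face maps are strictly increasing for the lexicographic order and avoid this. It
  remains to show that a crossing placed below a lift can be moved through it and comes out as
  crossings among genuine strands or among dummy strands, never between the two kinds.
  \<open>hecke_monoid\<close> is defined by reduced expressions of permutations, so arbitrary words
  must first be identified with reduced ones. One calculus serves for this in two quotients,
  selected by the flag of \<open>word_eq\<close>. With the flag off it is the positive braid monoid,
  where length and underlying permutation are invariants; this shows that the normal forms are
  reduced. With the flag on, \<open>\<pi>\<^sub>i\<^sup>2 = \<pi>\<^sub>i\<close> is added, and the
  same exchange steps bring every word to such a normal form. The right end of a word is the source
  of a diagram, so dummy crossings are deleted there.\<close>

inductive word_eq :: "bool \<Rightarrow> nat list \<Rightarrow> nat list \<Rightarrow> bool" for b where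
  idem: "b \<Longrightarrow> word_eq b (u @ [i, i] @ v) (u @ [i] @ v)"
| braid: "word_eq b (u @ [i, Suc i, i] @ v) (u @ [Suc i, i, Suc i] @ v)"
| comm: "Suc i < j \<Longrightarrow> word_eq b (u @ [i, j] @ v) (u @ [j, i] @ v)"
| refl: "word_eq b u u"
| sym: "word_eq b u v \<Longrightarrow> word_eq b v u"
| trans [trans]: "word_eq b u v \<Longrightarrow> word_eq b v w \<Longrightarrow> word_eq b u w"

lemma word_eq_mono: "word_eq False u v \<Longrightarrow> word_eq b u v"
proof (induction rule: word_eq.induct)
qed (blast intro: word_eq.intros)+

lemma word_eq_set: "word_eq b u v \<Longrightarrow> set u = set v"
  by (induction rule: word_eq.induct) auto

lemma word_eq_length: "word_eq False u v \<Longrightarrow> length u = length v"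
  by (induction rule: word_eq.induct) auto

lemma word_eq_context: "word_eq b v v' \<Longrightarrow> word_eq b (u @ v @ w) (u @ v' @ w)"
proof (induction rule: word_eq.induct)
  case (idem x i y)
  then show ?case using word_eq.idem[of b "u @ x" i "y @ w"] by simp
next
  case (braid x i y)
  then show ?case using word_eq.braid[of b "u @ x" i "y @ w"] by simp
next
  case (comm i j x y)
  then show ?case using word_eq.comm[of i j b "u @ x" "y @ w"] by simp
qed (blast intro: word_eq.intros)+

lemma word_eq_append:
  assumes "word_eq b u u'" "word_eq b v v'"
  shows "word_eq b (u @ v) (u' @ v')"
  using word_eq_context[OF assms(1), of "[]" v] word_eq_context[OF assms(2), of u' "[]"]
  by (auto intro: word_eq.trans)

lemma word_eq_Cons: "word_eq b v v' \<Longrightarrow> word_eq b (j # v) (j # v')"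
  using word_eq_append[OF word_eq.refl[of b "[j]"]] by simp

text \<open>Used with \<open>f\<close> the identity or a shift by one, the two ways in which letters
  change when a block travels through a run.\<close>

lemma word_eq_pass:
  assumes "\<And>j. j \<in> set w \<Longrightarrow> word_eq b (u @ [j]) (f j # u)"
  shows "word_eq b (u @ w) (map f w @ u)"
  using assms
proof (induction w)
  case Nil
  then show ?case by (simp add: word_eq.refl)
next
  case (Cons j w)
  have "word_eq b (u @ j # w) (f j # u @ w)"
    using word_eq_append[OF Cons.prems[of j] word_eq.refl[of b w]] by simp
  also have "word_eq b (f j # u @ w) (f j # map f w @ u)"
    using Cons by (intro word_eq_Cons) auto
  finally show ?case by simp
qed

lemma word_eq_swap:
  assumes "Suc i < j \<or> Suc j < i"
  shows "word_eq b (i # j # v) (j # i # v)"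
  using assms word_eq.comm[of i j b "[]" v] word_eq.comm[of j i b "[]" v]
  by (auto intro: word_eq.sym)

lemma word_eq_Cons_comm:
  assumes "\<And>i. i \<in> set u \<Longrightarrow> Suc i < j \<or> Suc j < i"
  shows "word_eq b (u @ [j]) (j # u)"
  using assms
proof (induction u)
  case Nil
  then show ?case by (simp add: word_eq.refl)
next
  case (Cons i u)
  have "word_eq b (i # u @ [j]) (i # j # u)"
    using Cons by (intro word_eq_Cons) auto
  also have "word_eq b (i # j # u) (j # i # u)"
    using Cons.prems by (intro word_eq_swap) auto
  finally show ?case by simp
qed

lemma word_eq_commute:
  assumes "\<And>i j. i \<in> set u \<Longrightarrow> j \<in> set w \<Longrightarrow> Suc i < j \<or> Suc j < i"
  shows "word_eq b (u @ w) (w @ u)"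
  using word_eq_pass[of w b u "\<lambda>j. j"] word_eq_Cons_comm[of u _ b] assms by auto

text \<open>For \<open>k \<le> x\<close> this is the cycle that carries position \<open>k\<close> to
  \<open>x\<close> and moves each of the positions \<open>Suc k\<close> to \<open>x\<close> down by
  one.\<close>

abbreviation desc :: "nat \<Rightarrow> nat \<Rightarrow> nat list" where
  "desc x k \<equiv> rev [k..<x]"

lemma desc_split: "k \<le> j \<Longrightarrow> j \<le> x \<Longrightarrow> desc x k = desc x j @ desc j k"
  by (metis le_Suc_ex rev_append upt_add_eq_append)

lemma desc_last: "k < x \<Longrightarrow> desc x k = desc x (Suc k) @ [k]"
  by (simp add: upt_conv_Cons)

text \<open>The braid relation acts once, on the letters \<open>Suc j, j\<close> of the run. The
  earlier letters of the run are at least \<open>j + 2\<close> and commute with \<open>j\<close>;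
  the later ones are below \<open>j\<close> and commute with \<open>Suc j\<close>.\<close>

lemma desc_pass:
  assumes "k \<le> j" "Suc j < x"
  shows "word_eq b (j # desc x k) (desc x k @ [Suc j])"
proof -
  have d: "desc x k = desc x (Suc (Suc j)) @ [Suc j, j] @ desc j k"
    using assms desc_split[of k "Suc (Suc j)" x] by simp
  have "word_eq b (([j] @ desc x (Suc (Suc j))) @ ([Suc j, j] @ desc j k))
     ((desc x (Suc (Suc j)) @ [j]) @ ([Suc j, j] @ desc j k))"
    by (intro word_eq_append word_eq_commute word_eq.refl) auto
  also have "word_eq b ((desc x (Suc (Suc j)) @ [j]) @ ([Suc j, j] @ desc j k))
     ((desc x (Suc (Suc j)) @ [Suc j, j]) @ ([Suc j] @ desc j k))"
    using word_eq.braid[of b "desc x (Suc (Suc j))" j "desc j k"] by simp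
  also have "word_eq b ((desc x (Suc (Suc j)) @ [Suc j, j]) @ ([Suc j] @ desc j k))
     ((desc x (Suc (Suc j)) @ [Suc j, j]) @ (desc j k @ [Suc j]))"
    by (intro word_eq_append word_eq_commute word_eq.refl) auto
  finally show ?thesis by (simp add: d)
qed

lemma upt_pass:
  assumes "c \<le> j" "Suc j < m"
  shows "word_eq b ([c..<m] @ [j]) (Suc j # [c..<m])"
proof -
  have "[c..<m] = [c..<j] @ [j..<m]" "[j..<m] = j # Suc j # [Suc (Suc j)..<m]"
    using assms upt_add_eq_append[of c j "m - j"] by (auto simp: upt_conv_Cons)
  then have d: "[c..<m] = [c..<j] @ [j, Suc j] @ [Suc (Suc j)..<m]" by simp
  have "word_eq b (([c..<j] @ [j, Suc j]) @ ([Suc (Suc j)..<m] @ [j]))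
     (([c..<j] @ [j, Suc j]) @ ([j] @ [Suc (Suc j)..<m]))"
    by (intro word_eq_append word_eq_commute word_eq.refl) auto
  also have "word_eq b (([c..<j] @ [j, Suc j]) @ ([j] @ [Suc (Suc j)..<m]))
     (([c..<j] @ [Suc j]) @ ([j, Suc j] @ [Suc (Suc j)..<m]))"
    using word_eq.braid[of b "[c..<j]" j "[Suc (Suc j)..<m]"] by simp
  also have "word_eq b (([c..<j] @ [Suc j]) @ ([j, Suc j] @ [Suc (Suc j)..<m]))
     (([Suc j] @ [c..<j]) @ ([j, Suc j] @ [Suc (Suc j)..<m]))"
    by (intro word_eq_append word_eq_commute word_eq.refl) auto
  finally show ?thesis by (simp add: d)
qed

lemma map_Suc_desc: "map Suc (desc x k) = desc (Suc x) (Suc k)"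
  by (simp add: map_Suc_upt flip: rev_map)

text \<open>The part of the run from \<open>c\<close> upwards passes through with all letters raised
  by one, which leaves a hole at \<open>c\<close>. The first letter of the ascending word fills it,
  and the remaining word, starting at \<open>Suc c\<close>, commutes with the rest of the
  run.\<close>

lemma upt_desc:
  assumes "k \<le> c" "c \<le> x" "x \<le> m"
  shows "word_eq b ([c..<Suc m] @ desc x k) (desc (Suc x) k @ [Suc c..<Suc m])"
proof -
  have "word_eq b ([c..<Suc m] @ desc x c) (map Suc (desc x c) @ [c..<Suc m])"
    using assms by (intro word_eq_pass upt_pass) auto
  from word_eq_append[OF this word_eq.refl[of b "desc c k"]]
  have "word_eq b (([c..<Suc m] @ desc x c) @ desc c k)
      ((map Suc (desc x c) @ [c..<Suc m]) @ desc c k)" .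
  also have "\<dots> = (desc (Suc x) (Suc c) @ [c]) @ ([Suc c..<Suc m] @ desc c k)"
    using assms unfolding map_Suc_desc by (simp add: upt_conv_Cons)
  also have "word_eq b \<dots> ((desc (Suc x) (Suc c) @ [c]) @ (desc c k @ [Suc c..<Suc m]))"
    by (intro word_eq_append word_eq_commute word_eq.refl) auto
  also have "\<dots> = desc (Suc x) k @ [Suc c..<Suc m]"
    using assms desc_split[of k c "Suc x"] desc_last[of c "Suc x"] by simp
  finally show ?thesis
    using assms desc_split[of k c x] by simp
qed

text \<open>A crossing of two neighbouring strands at their lower ends slides to their upper ends.
  Passing the second run of \<open>desc (Suc x) k @ desc (Suc x) (Suc k)\<close> through the first
  gives \<open>desc x k @ desc (Suc x) k\<close>; then \<open>x\<close> is split off in front on one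
  side and \<open>k\<close> at the end on the other.\<close>

lemma desc_desc:
  assumes "k \<le> x"
  shows "word_eq b (x # desc x k @ desc (Suc x) (Suc k)) (desc x k @ desc (Suc x) (Suc k) @ [k])"
proof -
  have "word_eq b (desc (Suc x) k @ desc (Suc x) (Suc k))
      (map (\<lambda>j. j - 1) (desc (Suc x) (Suc k)) @ desc (Suc x) k)"
  proof (rule word_eq_pass)
    fix j assume "j \<in> set (desc (Suc x) (Suc k))"
    then have "Suc k \<le> j" "j < Suc x" by (simp_all only: set_rev set_upt atLeastLessThan_iff)
    then obtain i where i: "j = Suc i" "k \<le> i" "i < x"
      by (cases j) auto
    show "word_eq b (desc (Suc x) k @ [j]) ((j - 1) # desc (Suc x) k)"
      unfolding i(1) diff_Suc_1 by (rule word_eq.sym) (rule desc_pass, use i in auto)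
  qed
  moreover have "map (\<lambda>j. j - 1) (map Suc (desc x k)) = desc x k"
    by (simp add: comp_def)
  ultimately have "word_eq b (desc (Suc x) k @ desc (Suc x) (Suc k)) (desc x k @ desc (Suc x) k)"
    by (simp only: map_Suc_desc)
  moreover have "desc (Suc x) k = x # desc x k" "desc (Suc x) k = desc (Suc x) (Suc k) @ [k]"
    using assms desc_last[of k "Suc x"] by simp_all
  ultimately show ?thesis by (metis append_Cons)
qed

section \<open>Normal forms and permutations\<close>

text \<open>Each block brings one strand, numbered from \<open>k\<close>, to its place. For
  increasing \<open>xs\<close> the earlier entries do not disturb the later ones and the strands end
  exactly at the entries; for a general \<open>lehmer_code\<close> the word is a normal form of a
  permutation.\<close>

fun shuffle_word :: "nat \<Rightarrow> nat list \<Rightarrow> nat list" where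
  "shuffle_word k [] = []"
| "shuffle_word k (x # xs) = desc x k @ shuffle_word (Suc k) xs"

lemma shuffle_word_upt [simp]: "shuffle_word k [k..<n] = []"
proof (induction "n - k" arbitrary: k)
  case 0
  then show ?case by simp
next
  case (Suc d)
  then show ?case by (simp add: upt_conv_Cons)
qed

lemma shuffle_word_letters:
  assumes "\<And>x. x \<in> set xs \<Longrightarrow> x \<le> m"
  shows "set (shuffle_word k xs) \<subseteq> {k..<m}"
  using assms
proof (induction xs arbitrary: k)
  case (Cons x xs)
  then have "set (shuffle_word (Suc k) xs) \<subseteq> {Suc k..<m}" "x \<le> m" by auto
  then show ?case by (auto simp: subset_iff)
qed simp

text \<open>When the position reaches \<open>m\<close> the only admissible entry is
  \<open>m\<close>, with empty block, so a code may stop there or one entry later. Different codes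
  can therefore give the same word, which is why uniqueness is stated below for words.\<close>

fun lehmer_code :: "nat \<Rightarrow> nat \<Rightarrow> nat list \<Rightarrow> bool" where
  "lehmer_code k m [] \<longleftrightarrow> m \<le> k"
| "lehmer_code k m (x # xs) \<longleftrightarrow> k \<le> x \<and> x \<le> m \<and> lehmer_code (Suc k) m xs"

lemma lehmer_code_bound: "lehmer_code k m xs \<Longrightarrow> x \<in> set xs \<Longrightarrow> x \<le> m"
  by (induction xs arbitrary: k) auto

lemma lehmer_code_letters: "lehmer_code k m xs \<Longrightarrow> set (shuffle_word k xs) \<subseteq> {k..<m}"
  by (rule shuffle_word_letters) (rule lehmer_code_bound)

text \<open>Exchange property, found by pushing \<open>j\<close> through the first run. If
  \<open>Suc j < x\<close> it leaves the run as \<open>Suc j\<close>, if \<open>x < j\<close> it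
  leaves as \<open>j\<close>, and the tail takes over. If \<open>j = x\<close> it lengthens the run;
  if \<open>Suc j = x\<close> the run itself begins with \<open>j\<close>. Only braid and
  commutation relations enter, so both quotients can use the result.\<close>

lemma lehmer_code_step:
  assumes "lehmer_code k m xs" "k \<le> j" "j < m"
  shows "\<exists>ys. lehmer_code k m ys \<and>
    (word_eq False (j # shuffle_word k xs) (shuffle_word k ys) \<or>
     word_eq False (shuffle_word k xs) (j # shuffle_word k ys))"
  using assms
proof (induction xs arbitrary: k j)
  case Nil
  then show ?case by simp
next
  case (Cons x xs)
  let ?w = "shuffle_word (Suc k)"
  have pass: ?case if i: "Suc k \<le> i" "i < m"
    and p: "word_eq False (j # desc x k) (desc x k @ [i])" for i
  proof -
    have q: "word_eq False (j # desc x k @ v) (desc x k @ i # v)" for v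
      using word_eq_append[OF p word_eq.refl[of False v]] by simp
    obtain ys where ys: "lehmer_code (Suc k) m ys"
      "word_eq False (i # ?w xs) (?w ys) \<or> word_eq False (?w xs) (i # ?w ys)"
      using Cons.IH[of "Suc k" i] Cons.prems i by auto
    have "word_eq False (j # shuffle_word k (x # xs)) (shuffle_word k (x # ys)) \<or>
      word_eq False (shuffle_word k (x # xs)) (j # shuffle_word k (x # ys))"
      using ys(2)
    proof
      assume "word_eq False (i # ?w xs) (?w ys)"
      from word_eq_append[OF word_eq.refl[of False "desc x k"] this] q[of "?w xs"]
      show ?thesis by (auto intro: word_eq.trans)
    next
      assume "word_eq False (?w xs) (i # ?w ys)"
      from word_eq_append[OF word_eq.refl[of False "desc x k"] this] q[of "?w ys"]
      show ?thesis by (auto intro: word_eq.trans word_eq.sym)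
    qed
    then show ?thesis
      using Cons.prems ys(1) by (intro exI[of _ "x # ys"]) auto
  qed
  consider "Suc j < x" | "Suc j = x" | "j = x" | "x < j" by linarith
  then show ?case
  proof cases
    case 1
    then show ?thesis
      using Cons.prems by (intro pass[of "Suc j"] desc_pass) auto
  next
    case 2
    then show ?thesis
      using Cons.prems by (intro exI[of _ "j # xs"]) (auto simp: word_eq.refl)
  next
    case 3
    then show ?thesis
      using Cons.prems by (intro exI[of _ "Suc x # xs"]) (auto simp: word_eq.refl)
  next
    case 4
    then show ?thesis
      using Cons.prems word_eq_commute[of "[j]" "desc x k" False] by (intro pass[of j]) auto
  qed
qed

lemma lehmer_code_identity: "\<exists>xs. lehmer_code k m xs \<and> shuffle_word k xs = []"
proof -
  have "lehmer_code k m [k..<m]"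
  proof (induction "m - k" arbitrary: k)
    case (Suc d)
    then show ?case by (simp add: upt_conv_Cons)
  qed simp
  then show ?thesis using shuffle_word_upt by blast
qed

lemma word_normal_form:
  assumes "set w \<subseteq> {k..<m}"
  shows "\<exists>xs. lehmer_code k m xs \<and> word_eq True w (shuffle_word k xs)"
  using assms
proof (induction w)
  case Nil
  then show ?case using lehmer_code_identity[of k m] by (auto simp: word_eq.refl)
next
  case (Cons j w)
  then obtain xs where xs: "lehmer_code k m xs" "word_eq True w (shuffle_word k xs)" by auto
  have j: "word_eq True (j # w) (j # shuffle_word k xs)" using xs by (intro word_eq_Cons)
  from lehmer_code_step[OF xs(1), of j] Cons.prems obtain ys where ys: "lehmer_code k m ys"
    "word_eq True (j # shuffle_word k xs) (shuffle_word k ys) \<or>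
     word_eq True (shuffle_word k xs) (j # shuffle_word k ys)"
    by (auto dest: word_eq_mono)
  from ys(2) show ?case
  proof
    assume "word_eq True (j # shuffle_word k xs) (shuffle_word k ys)"
    with j ys(1) show ?thesis by (blast intro: word_eq.trans)
  next
    assume a: "word_eq True (shuffle_word k xs) (j # shuffle_word k ys)"
    \<comment> \<open>The normal form can be rewritten to begin with \<open>j\<close>, so
      idempotency absorbs a further \<open>j\<close> and \<open>xs\<close> remains the code.\<close>
    have "word_eq True (j # shuffle_word k xs) (j # j # shuffle_word k ys)"
      using a by (rule word_eq_Cons)
    also have "word_eq True (j # j # shuffle_word k ys) (j # shuffle_word k ys)"
      using word_eq.idem[of True "[]" j] by simp
    also have "word_eq True (j # shuffle_word k ys) (shuffle_word k xs)"
      using a by (rule word_eq.sym)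
    finally show ?thesis using j xs(1) by (blast intro: word_eq.trans)
  qed
qed

section \<open>Shuffle words in the symmetric group: uniqueness and minimal length\<close>

lemma word_perm_Nil [simp]: "word_perm [] = id"
  by (simp add: word_perm_def)

lemma word_perm_Cons [simp]: "word_perm (j # w) = transpose j (Suc j) \<circ> word_perm w"
  by (simp add: word_perm_def)

lemma word_perm_append: "word_perm (u @ v) = word_perm u \<circ> word_perm v"
  by (induction u) auto

lemma word_perm_permutes:
  assumes "set w \<subseteq> {1..<n}"
  shows "word_perm w permutes {1..n}"
  using assms by (induction w) (auto intro!: permutes_compose permutes_swap_id permutes_id)

lemma word_perm_bij: "bij (word_perm w)"
  by (induction w) (simp_all only: word_perm_Nil word_perm_Cons bij_id bij_comp bij_transpose)

lemma word_perm_cong: "word_eq False u v \<Longrightarrow> word_perm u = word_perm v"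
proof (induction rule: word_eq.induct)
  case (braid u i v)
  have "transpose i (Suc i) (transpose (Suc i) (Suc (Suc i)) (transpose i (Suc i) x)) =
    transpose (Suc i) (Suc (Suc i)) (transpose i (Suc i) (transpose (Suc i) (Suc (Suc i)) x))" for x
    by (simp add: transpose_def)
  then show ?case by (simp add: word_perm_append fun_eq_iff)
next
  case (comm i j u v)
  then have "transpose i (Suc i) (transpose j (Suc j) x) =
    transpose j (Suc j) (transpose i (Suc i) x)" for x
    by (simp add: transpose_def)
  then show ?case by (simp add: word_perm_append fun_eq_iff)
qed simp_all

lemma word_perm_fixes:
  assumes "set w \<subseteq> {Suc k..<m}"
  shows "word_perm w k = k"
  using assms by (induction w) (auto simp: transpose_def)

lemma word_perm_desc: "k \<le> x \<Longrightarrow> word_perm (desc x k) k = x"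
  by (induction x rule: dec_induct) (auto simp: transpose_def)

text \<open>The later blocks fix \<open>k\<close>, so the permutation sends \<open>k\<close> to the
  first entry of the code. This entry is thus recovered, its run is cancelled by injectivity, and
  the tails are compared in the same way.\<close>

lemma word_perm_shuffle_word_inj:
  assumes "lehmer_code k m xs" "lehmer_code k m ys"
    "word_perm (shuffle_word k xs) = word_perm (shuffle_word k ys)"
  shows "shuffle_word k xs = shuffle_word k ys"
  using assms
proof (induction xs arbitrary: k ys)
  case Nil
  then show ?case using lehmer_code_letters[of k m ys] by simp
next
  case (Cons x xs)
  show ?case
  proof (cases ys)
    case Nil
    then have "m \<le> k" using Cons.prems(2) by simp
    then have "set (shuffle_word k (x # xs)) \<subseteq> {}"
      using lehmer_code_letters[OF Cons.prems(1)] by (simp only: atLeastLessThan_empty)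
    then show ?thesis using Nil by simp
  next
    case ys: (Cons y zs)
    have v: "word_perm (shuffle_word k (z # us)) k = z" if c: "lehmer_code k m (z # us)" for z us
    proof -
      have "set (shuffle_word (Suc k) us) \<subseteq> {Suc k..<m}"
        using c by (intro lehmer_code_letters) simp
      then have "word_perm (shuffle_word (Suc k) us) k = k" by (rule word_perm_fixes)
      then show ?thesis using c by (simp add: word_perm_append word_perm_desc)
    qed
    have "x = y"
      using v[OF Cons.prems(1)] v[of y zs] Cons.prems(2,3) unfolding ys by (simp only:)
    moreover have "word_perm (shuffle_word (Suc k) xs) = word_perm (shuffle_word (Suc k) zs)"
    proof
      fix i
      have "word_perm (desc x k) (word_perm (shuffle_word (Suc k) xs) i) =
          word_perm (desc x k) (word_perm (shuffle_word (Suc k) zs) i)"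
        using fun_cong[OF Cons.prems(3), of i] unfolding ys \<open>x = y\<close>
        by (simp add: word_perm_append)
      then show "word_perm (shuffle_word (Suc k) xs) i = word_perm (shuffle_word (Suc k) zs) i"
        by (rule injD[OF bij_is_inj[OF word_perm_bij]])
    qed
    ultimately show ?thesis
      using Cons.IH[of "Suc k" zs] Cons.prems ys by simp
  qed
qed

text \<open>Here the second exchange alternative cancels the square of a transposition and shortens
  the word. The length bound is what turns normal forms into reduced expressions.\<close>

lemma word_perm_normal_form:
  assumes "set w \<subseteq> {k..<m}"
  shows "\<exists>xs. lehmer_code k m xs \<and> word_perm w = word_perm (shuffle_word k xs) \<and>
    length (shuffle_word k xs) \<le> length w"
  using assms
proof (induction w)
  case Nil
  then show ?case using lehmer_code_identity[of k m] by fastforce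
next
  case (Cons j w)
  then obtain xs where xs: "lehmer_code k m xs" "word_perm w = word_perm (shuffle_word k xs)"
    "length (shuffle_word k xs) \<le> length w" by auto
  from lehmer_code_step[OF xs(1), of j] Cons.prems obtain ys where ys: "lehmer_code k m ys"
    "word_eq False (j # shuffle_word k xs) (shuffle_word k ys) \<or>
     word_eq False (shuffle_word k xs) (j # shuffle_word k ys)"
    by auto
  from ys(2) have "word_perm (j # shuffle_word k xs) = word_perm (shuffle_word k ys) \<and>
    length (shuffle_word k ys) \<le> Suc (length (shuffle_word k xs))"
  proof
    assume a: "word_eq False (j # shuffle_word k xs) (shuffle_word k ys)"
    show ?thesis using word_perm_cong[OF a] word_eq_length[OF a] by simp
  next
    assume a: "word_eq False (shuffle_word k xs) (j # shuffle_word k ys)"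
    show ?thesis using word_perm_cong[OF a] word_eq_length[OF a] by (simp add: fun_eq_iff)
  qed
  then show ?case using xs ys(1) by (intro exI[of _ ys]) simp
qed

text \<open>Minimality without counting inversions: a competing word has a normal form no longer
  than itself, and uniqueness identifies that normal form with the given word.\<close>

lemma reduced_expr_shuffle_word:
  assumes "lehmer_code 1 m xs"
  shows "reduced_expr m (word_perm (shuffle_word 1 xs)) (shuffle_word 1 xs)"
proof -
  have "set (shuffle_word 1 xs) \<subseteq> {1..<m}"
    using assms by (rule lehmer_code_letters)
  moreover have "length (shuffle_word 1 xs) \<le> length js"
    if js: "js \<in> lists {1..<m}" and "word_perm js = word_perm (shuffle_word 1 xs)" for js
  proof -
    have "set js \<subseteq> {1..<m}" using js by (simp add: in_lists_conv_set subset_iff)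
    then show ?thesis
      using word_perm_normal_form[of js 1 m] word_perm_shuffle_word_inj[OF assms] that
      by metis
  qed
  ultimately show ?thesis
    by (auto simp: reduced_expr_def)
qed

lemma finite_lehmer_code: "finite {xs. lehmer_code k m xs}"
proof -
  \<comment> \<open>The bound is \<open>Suc m - k\<close> because of the optional last entry of a
    code.\<close>
  have "length xs \<le> Suc m - k" if "lehmer_code k m xs" for xs
    using that
  proof (induction xs arbitrary: k)
    case (Cons x xs)
    then have "length xs \<le> Suc m - Suc k" by (intro Cons.IH) simp
    with Cons.prems show ?case by (simp add: Suc_diff_le)
  qed simp
  then have "{xs. lehmer_code k m xs} \<subseteq> {xs. set xs \<subseteq> {..m} \<and> length xs \<le> Suc m - k}"
    by (auto dest: lehmer_code_bound)
  then show ?thesis by (rule finite_subset) (rule finite_lists_length_le, simp)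
qed

section \<open>Order-preserving injections\<close>

definition face :: "nat \<Rightarrow> nat \<Rightarrow> nat" where
  "face c x = (if x < c then x else Suc x)"

text \<open>The lift of the face is pushed through the runs one by one. A run ending below
  \<open>c\<close> commutes with it; any other run is lengthened by one and uses up its first
  letter. Since the starting letter stays at least the current position, what remains after all runs
  crosses dummy strands only.\<close>

lemma shuffle_word_face:
  assumes "sorted_wrt (<) xs" "\<And>x. x \<in> set xs \<Longrightarrow> k \<le> x \<and> x \<le> m" "k \<le> c"
  shows "\<exists>t. set t \<subseteq> {k + length xs..<Suc m} \<and>
    word_eq b ([c..<Suc m] @ shuffle_word k xs) (shuffle_word k (map (face c) xs) @ t)"
  using assms
proof (induction xs arbitrary: k c)
  case Nil
  then show ?case
    by (intro exI[of _ "[c..<Suc m]"]) (auto simp: word_eq.refl simp del: upt_Suc)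
next
  case (Cons x xs)
  let ?c = "if x < c then c else Suc c"
  have step: "word_eq b ([c..<Suc m] @ desc x k) (desc (face c x) k @ [?c..<Suc m])"
  proof (cases "x < c")
    case True
    then show ?thesis
      using word_eq_commute[of "[c..<Suc m]" "desc x k" b]
      by (auto simp: face_def simp del: upt_Suc)
  next
    case False
    then show ?thesis
      using Cons.prems upt_desc[of k c x m b] by (simp add: face_def del: upt_Suc)
  qed
  have "\<And>y. y \<in> set xs \<Longrightarrow> Suc k \<le> y \<and> y \<le> m" "Suc k \<le> ?c" "sorted_wrt (<) xs"
    using Cons.prems by (auto simp: less_eq_Suc_le[symmetric] intro: order.strict_trans1)
  from Cons.IH[OF this(3,1,2)] obtain t where t: "set t \<subseteq> {Suc k + length xs..<Suc m}"
    "word_eq b ([?c..<Suc m] @ shuffle_word (Suc k) xs)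
       (shuffle_word (Suc k) (map (face ?c) xs) @ t)" by blast
  \<comment> \<open>If the threshold was raised to \<open>Suc c\<close>, then
    \<open>c \<le> x\<close>, and the remaining entries exceed \<open>x\<close>; both thresholds
    shift all of them.\<close>
  have eq: "map (face ?c) xs = map (face c) xs"
    using Cons.prems by (fastforce simp: face_def)
  have "word_eq b (([c..<Suc m] @ desc x k) @ shuffle_word (Suc k) xs)
      ((desc (face c x) k @ [?c..<Suc m]) @ shuffle_word (Suc k) xs)"
    by (intro word_eq_append step word_eq.refl)
  also have "(desc (face c x) k @ [?c..<Suc m]) @ shuffle_word (Suc k) xs =
      desc (face c x) k @ ([?c..<Suc m] @ shuffle_word (Suc k) xs)" by (rule append_assoc)
  also have "word_eq b \<dots>
      (desc (face c x) k @ (shuffle_word (Suc k) (map (face c) xs) @ t))"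
    using word_eq_append[OF word_eq.refl t(2)] unfolding eq .
  finally show ?case
    using t(1) by (intro exI[of _ t]) (simp del: upt_Suc)
qed

text \<open>A crossing is absorbed when it repeats the last crossing of a strand
  (\<open>Suc j = x\<close>), moves an endpoint \<open>x\<close> to a free position
  \<open>Suc x\<close>, emerges as a crossing of two genuine strands when \<open>Suc x\<close> is
  occupied, or passes all runs and crosses dummy strands. Preservation of lower bounds lets the
  induction put \<open>x\<close> back in front of \<open>ys\<close>. The letter that
  \<open>t\<close> must avoid is the one joining the last genuine strand to the first dummy; the
  image under \<open>Suc\<close> avoids truncated subtraction.\<close>

lemma shuffle_word_step:
  assumes "sorted_wrt (<) xs" "\<And>x. x \<in> set xs \<Longrightarrow> k \<le> x \<and> x \<le> m" "k \<le> j" "j < m"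
  shows "\<exists>ys t. sorted_wrt (<) ys \<and> length ys = length xs \<and>
    (\<forall>l. (\<forall>x\<in>set xs. l \<le> x) \<longrightarrow> (\<forall>y\<in>set ys. l \<le> y)) \<and> (\<forall>y\<in>set ys. y \<le> m) \<and>
    set t \<subseteq> {k..<m} \<and> k + length xs \<notin> Suc ` set t \<and>
    word_eq True (j # shuffle_word k xs) (shuffle_word k ys @ t)"
  using assms
proof (induction xs arbitrary: k j)
  case Nil
  then show ?case by (intro exI[of _ "[]"] exI[of _ "[j]"]) (auto simp: word_eq.refl)
next
  case (Cons x xs)
  let ?w = "shuffle_word (Suc k)"
  have xs: "sorted_wrt (<) xs" "\<And>y. y \<in> set xs \<Longrightarrow> Suc x \<le> y \<and> y \<le> m"
    "\<And>y. y \<in> set xs \<Longrightarrow> Suc k \<le> y \<and> y \<le> m" and x: "k \<le> x" "x \<le> m"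
    using Cons.prems by (auto simp: less_eq_Suc_le[symmetric] intro: order.strict_trans1)
  have pass: ?case if i: "Suc k \<le> i" "i < m"
    and p: "word_eq True (j # desc x k) (desc x k @ [i])" for i
  proof -
    from Cons.IH[OF xs(1,3) i] obtain ys t where ys: "sorted_wrt (<) ys" "length ys = length xs"
      "\<forall>l. (\<forall>x\<in>set xs. l \<le> x) \<longrightarrow> (\<forall>y\<in>set ys. l \<le> y)" "\<forall>y\<in>set ys. y \<le> m"
      and t: "set t \<subseteq> {Suc k..<m}" "Suc k + length xs \<notin> Suc ` set t"
      "word_eq True (i # ?w xs) (?w ys @ t)"
      by blast
    have "word_eq True ((j # desc x k) @ ?w xs) ((desc x k @ [i]) @ ?w xs)"
      by (intro word_eq_append p word_eq.refl)
    also have "(desc x k @ [i]) @ ?w xs = desc x k @ (i # ?w xs)" by simp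
    also have "word_eq True \<dots> (desc x k @ (?w ys @ t))"
      by (intro word_eq_append t word_eq.refl)
    finally have "word_eq True (j # shuffle_word k (x # xs)) (shuffle_word k (x # ys) @ t)"
      by simp
    moreover have "sorted_wrt (<) (x # ys)"
      using ys xs(2) by (auto simp: less_eq_Suc_le)
    ultimately show ?thesis
      using ys t x by (intro exI[of _ "x # ys"] exI[of _ t]) auto
  qed
  consider "Suc j < x" | "Suc j = x" | "j = x" | "x < j" by linarith
  then show ?case
  proof cases
    case 1
    with x have "Suc j < m" by simp
    with 1 show ?thesis
      using Cons.prems by (intro pass[of "Suc j"] desc_pass) auto
  next
    case 2
    then show ?thesis
      using Cons.prems word_eq.idem[of True "[]" j "desc j k @ ?w xs"]
      by (intro exI[of _ "x # xs"] exI[of _ "[]"]) auto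
  next
    case 3
    show ?thesis
    proof (cases "Suc x \<in> set xs")
      case True
      then obtain y zs where zs: "xs = y # zs" by (cases xs) auto
      then have "y = Suc x" using True xs(1,2) by force
      have d: "word_eq True (x # desc x k @ desc (Suc x) (Suc k))
          (desc x k @ desc (Suc x) (Suc k) @ [k])"
        using x by (intro desc_desc) auto
      have "word_eq True ((x # desc x k @ desc (Suc x) (Suc k)) @ shuffle_word (Suc (Suc k)) zs)
          ((desc x k @ desc (Suc x) (Suc k) @ [k]) @ shuffle_word (Suc (Suc k)) zs)"
        by (rule word_eq_append[OF d word_eq.refl])
      also have "(desc x k @ desc (Suc x) (Suc k) @ [k]) @ shuffle_word (Suc (Suc k)) zs =
        (desc x k @ desc (Suc x) (Suc k)) @ ([k] @ shuffle_word (Suc (Suc k)) zs)"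
        by (simp del: upt_Suc)
      also have "word_eq True \<dots>
          ((desc x k @ desc (Suc x) (Suc k)) @ (shuffle_word (Suc (Suc k)) zs @ [k]))"
      proof (rule word_eq_append[OF word_eq.refl word_eq_commute])
        fix i j assume "i \<in> set [k]" "j \<in> set (shuffle_word (Suc (Suc k)) zs)"
        moreover have "set (shuffle_word (Suc (Suc k)) zs) \<subseteq> {Suc (Suc k)..<m}"
          using Cons.prems(2) zs by (intro shuffle_word_letters) auto
        ultimately show "Suc i < j \<or> Suc j < i" by auto
      qed
      finally have w: "word_eq True (j # shuffle_word k (x # xs)) (shuffle_word k (x # xs) @ [k])"
        using zs \<open>y = Suc x\<close> 3 by (simp del: upt_Suc)
      have "k < m" using x(1) 3 Cons.prems(4) by simp
      show ?thesis
      proof (intro exI conjI)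
        show "word_eq True (j # shuffle_word k (x # xs)) (shuffle_word k (x # xs) @ [k])" by fact
        show "sorted_wrt (<) (x # xs)" by fact
        show "\<forall>y\<in>set (x # xs). y \<le> m" using Cons.prems(2) by blast
      qed (use \<open>k < m\<close> zs in auto)
    next
      case False
      then have "\<And>y. y \<in> set xs \<Longrightarrow> Suc x < y"
        using xs(2) by (metis le_neq_implies_less)
      then show ?thesis
        using Cons.prems xs(1) 3
        by (intro exI[of _ "Suc x # xs"] exI[of _ "[]"]) (auto simp: word_eq.refl)
    qed
  next
    case 4
    with x have "Suc k \<le> j" by simp
    with 4 show ?thesis
      using Cons.prems word_eq_commute[of "[j]" "desc x k" True] by (intro pass[of j]) auto
  qed
qed

text \<open>Without the letter \<open>n\<close>, letters on either side of it are at distance at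
  least two and commute. This separates crossings of genuine strands from crossings of dummy
  strands.\<close>

lemma word_eq_split:
  assumes "n \<notin> set u"
  shows "word_eq b u (filter (\<lambda>i. i < n) u @ filter (\<lambda>i. n < i) u)"
  using assms
proof (induction u)
  case Nil
  then show ?case by (simp add: word_eq.refl)
next
  case (Cons i u)
  let ?f = "filter (\<lambda>i. i < n) u" and ?g = "filter (\<lambda>i. n < i) u"
  have IH: "word_eq b (i # u) (i # ?f @ ?g)"
    using Cons by (intro word_eq_Cons) auto
  show ?case
  proof (cases "i < n")
    case True
    then show ?thesis using IH by simp
  next
    case False
    with Cons.prems have "n < i" by auto
    have "word_eq b (([i] @ ?f) @ ?g) ((?f @ [i]) @ ?g)"
      using \<open>n < i\<close> by (intro word_eq_append word_eq_commute word_eq.refl) auto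
    with IH \<open>n < i\<close> show ?thesis by (auto intro: word_eq.trans)
  qed
qed

text \<open>
  Increasing lists \<open>xs\<close> of length \<open>n\<close> with entries in \<open>{1..m}\<close> are the order-preserving
  injections of \<open>[n]\<close> into \<open>[m]\<close>; \<open>shuffle_word 1 xs\<close> is the diagram in which the dummy
  strands do not cross each other.
\<close>

definition oi :: "nat \<Rightarrow> nat \<Rightarrow> nat list set" where
  "oi n m = {xs. sorted_wrt (<) xs \<and> set xs \<subseteq> {1..m} \<and> length xs = n}"

text \<open>The letters of \<open>w\<close> enter the lift one at a time, starting with the letter
  next to it. The letters that come out avoid \<open>n\<close> and split into \<open>v\<close>, an
  element of the small monoid acting on the source, and \<open>t\<close>, which is deleted in the
  quotient.\<close>

lemma oi_word_factor:
  assumes "xs \<in> oi n m" "set w \<subseteq> {1..<m}"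
  shows "\<exists>ys v t. ys \<in> oi n m \<and> set v \<subseteq> {1..<n} \<and> set t \<subseteq> {n + 1..<m} \<and>
    word_eq True (w @ shuffle_word 1 xs) (shuffle_word 1 ys @ v @ t)"
proof -
  have "\<exists>ys u. ys \<in> oi n m \<and> set u \<subseteq> {1..<m} \<and> n \<notin> set u \<and>
    word_eq True (w @ shuffle_word 1 xs) (shuffle_word 1 ys @ u)"
    using assms(2)
  proof (induction w)
    case Nil
    then show ?case
      using assms(1) by (intro exI[of _ xs] exI[of _ "[]"]) (auto simp: word_eq.refl)
  next
    case (Cons j w)
    then obtain ys u where ys: "ys \<in> oi n m" "set u \<subseteq> {1..<m}" "n \<notin> set u"
      "word_eq True (w @ shuffle_word 1 xs) (shuffle_word 1 ys @ u)" by auto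
    have "sorted_wrt (<) ys" "\<And>y. y \<in> set ys \<Longrightarrow> 1 \<le> y \<and> y \<le> m" "1 \<le> j" "j < m"
      using ys(1) Cons.prems by (auto simp: oi_def)
    from shuffle_word_step[OF this] obtain zs t where zs: "sorted_wrt (<) zs" "length zs = length ys"
      "\<forall>l. (\<forall>x\<in>set ys. l \<le> x) \<longrightarrow> (\<forall>y\<in>set zs. l \<le> y)" "\<forall>y\<in>set zs. y \<le> m"
      "set t \<subseteq> {1..<m}" "1 + length ys \<notin> Suc ` set t"
      "word_eq True (j # shuffle_word 1 ys) (shuffle_word 1 zs @ t)" by blast
    have "\<forall>x\<in>set ys. 1 \<le> x" using ys(1) by (auto simp: oi_def)
    with zs(3) have "\<forall>y\<in>set zs. 1 \<le> y" by blast
    then have "zs \<in> oi n m"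
      using ys(1) zs(1,2,4) by (auto simp: oi_def)
    moreover have "n \<notin> set (t @ u)"
      using ys zs(6) by (auto simp: oi_def)
    moreover have "word_eq True ((j # w) @ shuffle_word 1 xs) (shuffle_word 1 zs @ (t @ u))"
      using word_eq_Cons[OF ys(4), of j] word_eq_append[OF zs(7) word_eq.refl[of True u]]
      by (auto intro: word_eq.trans)
    ultimately show ?case using ys(2) zs(5)
      by (intro exI[of _ zs] exI[of _ "t @ u"]) auto
  qed
  then obtain ys u where ys: "ys \<in> oi n m" "set u \<subseteq> {1..<m}" "n \<notin> set u"
    "word_eq True (w @ shuffle_word 1 xs) (shuffle_word 1 ys @ u)" by blast
  have "word_eq True (shuffle_word 1 ys @ u)
      (shuffle_word 1 ys @ filter (\<lambda>i. i < n) u @ filter (\<lambda>i. n < i) u)"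
    by (intro word_eq_append word_eq_split word_eq.refl ys)
  with ys show ?thesis
    by (intro exI[of _ ys] exI[of _ "filter (\<lambda>i. i < n) u"] exI[of _ "filter (\<lambda>i. n < i) u"])
      (auto intro: word_eq.trans)
qed

lemma oi_face:
  assumes "xs \<in> oi n m" "c \<in> {1..Suc m}"
  shows "map (face c) xs \<in> oi n (Suc m)"
  using assms by (fastforce simp: oi_def face_def sorted_wrt_map
    intro: sorted_wrt_mono_rel[of _ "(<)"])

section \<open>Words in the 0-Hecke algebra\<close>

lemma finite_hecke_words: "\<exists>W. finite W \<and> W \<subseteq> lists {1..<n} \<and>
  (\<forall>w \<in> lists {1..<n}. \<exists>v\<in>W. word_eq True w v)"
proof -
  let ?W = "shuffle_word 1 ` {xs. lehmer_code 1 n xs}"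
  have "?W \<subseteq> lists {1..<n}"
    using lehmer_code_letters[of 1 n] by (auto simp: in_lists_conv_set subset_iff)
  moreover have "\<exists>v\<in>?W. word_eq True w v" if "w \<in> lists {1..<n}" for w
    using word_normal_form[of w 1 n] that by (auto simp: in_lists_conv_set subset_iff)
  ultimately show ?thesis
    using finite_lehmer_code[of 1 n] by (intro exI[of _ ?W]) auto
qed

context ring
begin

lemma word_conv_monom: "word_conv R (word_monom R u) (word_monom R v) = word_monom R (u @ v)"
proof
  fix w
  have c: "word_monom R x y \<in> carrier R" for x y :: "'c list"
    by (simp add: word_monom_def)
  show "word_conv R (word_monom R u) (word_monom R v) w = word_monom R (u @ v) w"
  proof (induction u arbitrary: w)
    case Nil
    then show ?case using word_conv_one_l[of "word_monom R v"] c by simp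
  next
    case (Cons a u)
    show ?case
    proof (cases w)
      case Nil
      then show ?thesis using c
        by (subst Nil, subst word_conv_Nil) (auto simp: word_monom_def)
    next
      case w: (Cons b x)
      have "(\<lambda>y. word_monom R (a # u) (b # y)) = (if a = b then word_monom R u else (\<lambda>_. \<zero>))"
        by (auto simp: word_monom_def)
      then show ?thesis
        unfolding w using c Cons.IH
        by (subst word_conv_Cons) (auto simp: word_conv_zero_l, auto simp: word_monom_def)
    qed
  qed
qed

text \<open>Additive inverses are described relative to a carrier and so depend formally on the
  alphabet. The pointwise formula makes the relators for different \<open>n\<close>
  comparable.\<close>

lemma free_algebra_uminus:
  assumes "f \<in> carrier (free_algebra R A)"
  shows "\<ominus>\<^bsub>free_algebra R A\<^esub> f = (\<lambda>w. \<ominus> f w)"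
proof -
  interpret F: ring "free_algebra R A" by (rule free_algebra_ring)
  have "{w. \<ominus> f w \<noteq> \<zero>} \<subseteq> {w. f w \<noteq> \<zero>}" by auto
  then have "(\<lambda>w. \<ominus> f w) \<in> carrier (free_algebra R A)"
    using assms by (auto simp: free_algebra_def intro: finite_subset)
  moreover have "(\<lambda>w. \<ominus> f w) \<oplus>\<^bsub>free_algebra R A\<^esub> f = \<zero>\<^bsub>free_algebra R A\<^esub>"
    using assms by (auto simp: free_algebra_def l_neg)
  ultimately show ?thesis
    using assms by (intro F.minus_equality)
qed

lemma free_algebra_carrier_mono:
  "A \<subseteq> B \<Longrightarrow> carrier (free_algebra R A) \<subseteq> carrier (free_algebra R B)"
  by (auto simp: free_algebra_def dest: lists_mono)

text \<open>The larger ideal, intersected with the smaller free algebra, is an ideal there and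
  contains the smaller relators; minimality of the generated ideal gives the inclusion.\<close>

lemma hecke_ideal_mono:
  assumes "n \<le> m"
  shows "hecke_ideal R n \<subseteq> hecke_ideal R m"
proof -
  interpret Fn: ring "hecke_free R n" by (rule free_algebra_ring)
  interpret Fm: ring "hecke_free R m" by (rule free_algebra_ring)
  interpret I: ideal "hecke_ideal R m" "hecke_free R m" by (rule hecke_ideal_ideal)
  let ?J = "hecke_ideal R m \<inter> carrier (hecke_free R n)"
  have sub: "carrier (hecke_free R n) \<subseteq> carrier (hecke_free R m)"
    using assms by (intro free_algebra_carrier_mono) auto
  have ops: "x \<oplus>\<^bsub>hecke_free R n\<^esub> y = x \<oplus>\<^bsub>hecke_free R m\<^esub> y"
    "x \<otimes>\<^bsub>hecke_free R n\<^esub> y = x \<otimes>\<^bsub>hecke_free R m\<^esub> y"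
    "\<zero>\<^bsub>hecke_free R n\<^esub> = \<zero>\<^bsub>hecke_free R m\<^esub>" for x y
    by (simp_all add: free_algebra_def)
  have uminus: "\<ominus>\<^bsub>hecke_free R n\<^esub> x = \<ominus>\<^bsub>hecke_free R m\<^esub> x"
    if "x \<in> carrier (hecke_free R n)" for x
    using that sub by (simp add: free_algebra_uminus subset_iff)
  have minus: "x \<ominus>\<^bsub>hecke_free R n\<^esub> y = x \<ominus>\<^bsub>hecke_free R m\<^esub> y"
    if "x \<in> carrier (hecke_free R n)" "y \<in> carrier (hecke_free R n)" for x y
    using that unfolding a_minus_def ops(1) by (simp only: uminus)
  have "ideal ?J (hecke_free R n)"
  proof (rule idealI)
    show "ring (hecke_free R n)" by (rule free_algebra_ring)
    show "subgroup ?J (add_monoid (hecke_free R n))"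
    proof (rule Fn.add.subgroupI)
      have "\<zero>\<^bsub>hecke_free R n\<^esub> \<in> ?J"
        using I.zero_closed Fn.zero_closed unfolding ops(3) by (simp only: Int_iff simp_thms)
      then show "?J \<noteq> {}" by blast
    next
      fix x assume "x \<in> ?J"
      then show "\<ominus>\<^bsub>hecke_free R n\<^esub> x \<in> ?J"
        using uminus[of x] I.a_inv_closed[of x] Fn.a_inv_closed[of x] by (simp only: Int_iff simp_thms)
    next
      fix x y assume "x \<in> ?J" "y \<in> ?J"
      then show "x \<oplus>\<^bsub>hecke_free R n\<^esub> y \<in> ?J"
        using I.a_closed[of x y] Fn.a_closed[of x y] by (simp only: Int_iff simp_thms ops(1))
    qed auto
  next
    fix a x assume a: "a \<in> ?J" "x \<in> carrier (hecke_free R n)"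
    then show "x \<otimes>\<^bsub>hecke_free R n\<^esub> a \<in> ?J"
      using I.I_l_closed[of a x] Fn.m_closed[of x a] sub by (simp only: Int_iff simp_thms ops(2)) blast
    show "a \<otimes>\<^bsub>hecke_free R n\<^esub> x \<in> ?J"
      using a I.I_r_closed[of a x] Fn.m_closed[of a x] sub by (simp only: Int_iff simp_thms ops(2)) blast
  qed
  moreover have "hecke_relators R n \<subseteq> ?J"
  proof
    fix x assume x: "x \<in> hecke_relators R n"
    have "hecke_relators R n \<subseteq> carrier (hecke_free R n)"
      by (auto simp: hecke_relators_def simp del: One_nat_def
          intro!: Fn.minus_closed word_monom_closed)
    moreover have "x \<in> hecke_relators R m"
    proof -
      have monom: "word_monom R u \<ominus>\<^bsub>hecke_free R n\<^esub> word_monom R v =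
          word_monom R u \<ominus>\<^bsub>hecke_free R m\<^esub> word_monom R v"
        if "u \<in> lists {1..<n}" "v \<in> lists {1..<n}" for u v
        using that by (intro minus word_monom_closed)
      consider
        i where "i \<in> {1..<n}"
          "x = word_monom R [i, i] \<ominus>\<^bsub>hecke_free R n\<^esub> word_monom R [i]"
        | i where "i \<in> {1..<n}" "Suc i \<in> {1..<n}"
          "x = word_monom R [i, Suc i, i] \<ominus>\<^bsub>hecke_free R n\<^esub> word_monom R [Suc i, i, Suc i]"
        | i j where "i \<in> {1..<n}" "j \<in> {1..<n}" "\<bar>int i - int j\<bar> > 1"
          "x = word_monom R [i, j] \<ominus>\<^bsub>hecke_free R n\<^esub> word_monom R [j, i]"
        using x unfolding hecke_relators_def by blast
      then show ?thesis
      proof cases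
        case 1
        then have "x = word_monom R [i, i] \<ominus>\<^bsub>hecke_free R m\<^esub> word_monom R [i]" "i \<in> {1..<m}"
          using assms monom[of "[i, i]" "[i]"] by auto
        then show ?thesis unfolding hecke_relators_def by blast
      next
        case 2
        then have "x = word_monom R [i, Suc i, i] \<ominus>\<^bsub>hecke_free R m\<^esub> word_monom R [Suc i, i, Suc i]"
          "i \<in> {1..<m}" "Suc i \<in> {1..<m}"
          using assms monom[of "[i, Suc i, i]" "[Suc i, i, Suc i]"] by auto
        then show ?thesis unfolding hecke_relators_def by blast
      next
        case 3
        then have "x = word_monom R [i, j] \<ominus>\<^bsub>hecke_free R m\<^esub> word_monom R [j, i]"
          "i \<in> {1..<m}" "j \<in> {1..<m}"
          using assms monom[of "[i, j]" "[j, i]"] by auto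
        with 3(3) show ?thesis unfolding hecke_relators_def by blast
      qed
    qed
    moreover have "hecke_relators R m \<subseteq> hecke_ideal R m"
      unfolding hecke_ideal_def
      by (rule Fm.genideal_self) (auto simp: hecke_relators_def simp del: One_nat_def
          intro!: Fm.minus_closed word_monom_closed)
    ultimately show "x \<in> ?J" using x by blast
  qed
  ultimately have "hecke_ideal R n \<subseteq> ?J"
    unfolding hecke_ideal_def[of R n] by (rule Fn.genideal_minimal)
  then show ?thesis by blast
qed

lemma hecke_word_mult:
  assumes "u \<in> lists {1..<n}" "v \<in> lists {1..<n}"
  shows "hecke_word R n u \<otimes>\<^bsub>hecke_algebra R n\<^esub> hecke_word R n v = hecke_word R n (u @ v)"
proof -
  interpret I: ideal "hecke_ideal R n" "hecke_free R n" by (rule hecke_ideal_ideal)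
  have "word_monom R u \<otimes>\<^bsub>hecke_free R n\<^esub> word_monom R v = word_monom R (u @ v)"
    by (simp add: free_algebra_def word_conv_monom)
  then show ?thesis
    using I.rcoset_mult_add[OF word_monom_closed[OF assms(1)] word_monom_closed[OF assms(2)]]
    by (simp add: hecke_algebra_def hecke_word_def FactRing_def)
qed

lemma hecke_algebra_one: "\<one>\<^bsub>hecke_algebra R n\<^esub> = hecke_word R n []"
  by (simp add: hecke_algebra_def hecke_word_def FactRing_def free_algebra_def)

lemma hecke_word_relator:
  assumes "word_monom R u \<ominus>\<^bsub>hecke_free R n\<^esub> word_monom R v \<in> hecke_relators R n"
    and "u \<in> lists {1..<n}" "v \<in> lists {1..<n}"
  shows "hecke_word R n u = hecke_word R n v"
proof -
  interpret F: ring "hecke_free R n" by (rule free_algebra_ring)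
  have "hecke_relators R n \<subseteq> hecke_ideal R n"
    unfolding hecke_ideal_def
    by (rule F.genideal_self) (auto simp: hecke_relators_def simp del: One_nat_def
        intro!: F.minus_closed word_monom_closed)
  then show ?thesis
    using assms F.quotient_eq_iff_same_a_r_cos[OF hecke_ideal_ideal[of n]
        word_monom_closed[OF assms(2)] word_monom_closed[OF assms(3)]]
    by (auto simp: hecke_word_def)
qed

lemma hecke_word_context:
  assumes "hecke_word R n u = hecke_word R n v"
    "x @ u @ y \<in> lists {1..<n}" "v \<in> lists {1..<n}"
  shows "hecke_word R n (x @ u @ y) = hecke_word R n (x @ v @ y)"
  using assms hecke_word_mult[of x n "u @ y"] hecke_word_mult[of x n "v @ y"]
    hecke_word_mult[of u n y] hecke_word_mult[of v n y]
  by (metis append_in_lists_conv)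

lemma hecke_word_idem:
  assumes "i \<in> {1..<n}"
  shows "hecke_word R n [i, i] = hecke_word R n [i]"
proof (rule hecke_word_relator)
  show "word_monom R [i, i] \<ominus>\<^bsub>hecke_free R n\<^esub> word_monom R [i] \<in> hecke_relators R n"
    using assms unfolding hecke_relators_def by blast
qed (use assms in auto)

lemma hecke_word_braid:
  assumes "i \<in> {1..<n}" "Suc i \<in> {1..<n}"
  shows "hecke_word R n [i, Suc i, i] = hecke_word R n [Suc i, i, Suc i]"
proof (rule hecke_word_relator)
  show "word_monom R [i, Suc i, i] \<ominus>\<^bsub>hecke_free R n\<^esub> word_monom R [Suc i, i, Suc i]
      \<in> hecke_relators R n"
    using assms unfolding hecke_relators_def by blast
qed (use assms in auto)

lemma hecke_word_comm:
  assumes "i \<in> {1..<n}" "j \<in> {1..<n}" "Suc i < j"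
  shows "hecke_word R n [i, j] = hecke_word R n [j, i]"
proof (rule hecke_word_relator)
  have "\<bar>int i - int j\<bar> > 1" using assms(3) by linarith
  then show "word_monom R [i, j] \<ominus>\<^bsub>hecke_free R n\<^esub> word_monom R [j, i] \<in> hecke_relators R n"
    using assms(1,2) unfolding hecke_relators_def by blast
qed (use assms in auto)

lemma hecke_word_cong:
  assumes "word_eq True u v" "u \<in> lists {1..<n}"
  shows "hecke_word R n u = hecke_word R n v"
  using assms
proof (induction rule: word_eq.induct)
  case (idem u i v)
  then show ?case by (intro hecke_word_context hecke_word_idem) auto
next
  case (braid u i v)
  then show ?case by (intro hecke_word_context hecke_word_braid) auto
next
  case (comm i j u v)
  then show ?case by (intro hecke_word_context hecke_word_comm) auto
next
  case (sym u v)
  then show ?case using word_eq_set[OF sym.hyps] by (auto simp: in_lists_conv_set)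
next
  case (trans u v w)
  then show ?case using word_eq_set[OF trans.hyps(1)] by (auto simp: in_lists_conv_set)
qed simp

text \<open>From here on words need not be reduced: every word equals its normal form in the
  algebra, and normal forms are reduced expressions.\<close>

lemma hecke_monoid_words: "hecke_monoid R n = hecke_word R n ` lists {1..<n}"
proof
  show "hecke_monoid R n \<subseteq> hecke_word R n ` lists {1..<n}"
    by (auto simp: hecke_monoid_def reduced_expr_def)
  show "hecke_word R n ` lists {1..<n} \<subseteq> hecke_monoid R n"
  proof
    fix x assume "x \<in> hecke_word R n ` lists {1..<n}"
    then obtain w where w: "w \<in> lists {1..<n}" "x = hecke_word R n w" by blast
    then obtain xs where xs: "lehmer_code 1 n xs" "word_eq True w (shuffle_word 1 xs)"
      using word_normal_form[of w 1 n] by (auto simp: in_lists_conv_set subset_iff)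
    then have "x = hecke_word R n (shuffle_word 1 xs)"
      using w hecke_word_cong by simp
    then show "x \<in> hecke_monoid R n"
      using reduced_expr_shuffle_word[OF xs(1)] word_perm_permutes[OF lehmer_code_letters[OF xs(1)]]
      unfolding hecke_monoid_def by blast
  qed
qed

lemma hecke_incl_word:
  assumes "n \<le> m" "w \<in> lists {1..<n}"
  shows "hecke_incl R m (hecke_word R n w) = hecke_word R m w"
proof -
  interpret Fm: ring "hecke_free R m" by (rule free_algebra_ring)
  interpret In: ideal "hecke_ideal R n" "hecke_free R n" by (rule hecke_ideal_ideal)
  interpret Im: ideal "hecke_ideal R m" "hecke_free R m" by (rule hecke_ideal_ideal)
  have w: "word_monom R w \<in> carrier (hecke_free R n)" "word_monom R w \<in> carrier (hecke_free R m)"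
    using assms by (auto intro!: word_monom_closed simp: in_lists_conv_set)
  have "hecke_ideal R m +>\<^bsub>hecke_free R m\<^esub> a = hecke_word R m w"
    if "a \<in> hecke_word R n w" for a
  proof -
    from that obtain i where i: "i \<in> hecke_ideal R n" "a = i \<oplus>\<^bsub>hecke_free R n\<^esub> word_monom R w"
      by (auto simp: hecke_word_def a_r_coset_def' )
    then have "a \<in> hecke_ideal R m +>\<^bsub>hecke_free R m\<^esub> word_monom R w"
      using hecke_ideal_mono[OF assms(1)] by (auto simp: a_r_coset_def' free_algebra_def)
    then show ?thesis
      using Im.a_repr_independence' w(2) by (simp add: hecke_word_def)
  qed
  moreover have "word_monom R w \<in> hecke_word R n w"
    using In.a_rcos_self w(1) by (simp add: hecke_word_def)
  ultimately show ?thesis by (auto simp: hecke_incl_def)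
qed

end

section \<open>Morphisms as classes of words\<close>

definition hecke_class :: "('k, 'r) ring_scheme \<Rightarrow> nat \<Rightarrow> nat \<Rightarrow> nat list \<Rightarrow> 'k hecke_mor" where
  "hecke_class K n m w = hecke_hom_equiv K n m `` {hecke_word K m w}"

context ring
begin

lemma hecke_hom_equiv_equiv: "equiv (hecke_monoid R m) (hecke_hom_equiv R n m)"
proof (rule equivI)
  have "(x, y) \<in> hecke_hom_equiv R n m \<Longrightarrow> x \<in> hecke_monoid R m \<and> y \<in> hecke_monoid R m" for x y
  proof (induction rule: hecke_hom_equiv.induct)
    case (gen x j)
    then have j: "[j] \<in> lists {1..<m}" by auto
    from gen obtain w where w: "w \<in> lists {1..<m}" "x = hecke_word R m w"
      by (auto simp: hecke_monoid_words)
    then have "x \<otimes>\<^bsub>hecke_algebra R m\<^esub> hecke_word R m [j] = hecke_word R m (w @ [j])"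
      using hecke_word_mult j by simp
    moreover have "w @ [j] \<in> lists {1..<m}" using w(1) j by simp
    ultimately show ?case
      using gen(1) by (auto simp: hecke_monoid_words)
  qed auto
  then show "hecke_hom_equiv R n m \<subseteq> hecke_monoid R m \<times> hecke_monoid R m" by auto
qed (auto intro!: refl_onI symI transI intro: hecke_hom_equiv.intros)

lemma hecke_class_eqI:
  "(hecke_word R m u, hecke_word R m v) \<in> hecke_hom_equiv R n m \<Longrightarrow>
    hecke_class R n m u = hecke_class R n m v"
  unfolding hecke_class_def by (rule equiv_class_eq[OF hecke_hom_equiv_equiv])

lemma hecke_hom_eq:
  "hecke_hom R n m = (if n \<le> m then hecke_class R n m ` lists {1..<m} else {})"
  by (auto simp: hecke_hom_def quotient_def hecke_class_def hecke_monoid_words)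

lemma hecke_class_cong:
  assumes "word_eq True u v" "u \<in> lists {1..<m}"
  shows "hecke_class R n m u = hecke_class R n m v"
  using hecke_word_cong[OF assms] by (simp add: hecke_class_def)

text \<open>Deletion of dummy strands, one trailing letter at a time by the generating
  relation.\<close>

lemma hecke_class_append:
  assumes "w \<in> lists {1..<m}" "t \<in> lists {n + 1..<m}"
  shows "hecke_class R n m (w @ t) = hecke_class R n m w"
  using assms(2)
proof (induction t rule: rev_induct)
  case (snoc j t)
  have "lists {n + 1..<m} \<subseteq> lists {1..<m}" by (rule lists_mono) auto
  then have wt: "w @ t \<in> lists {1..<m}" "[j] \<in> lists {1..<m}"
    using assms(1) snoc.prems by auto
  from wt(1) have "hecke_word R m (w @ t) \<in> hecke_monoid R m"
    unfolding hecke_monoid_words by (rule imageI)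
  moreover have "j \<in> {n + 1..<m}" using snoc.prems by auto
  ultimately have "(hecke_word R m (w @ t),
      hecke_word R m (w @ t) \<otimes>\<^bsub>hecke_algebra R m\<^esub> hecke_word R m [j]) \<in> hecke_hom_equiv R n m"
    by (rule hecke_hom_equiv.gen)
  moreover have "hecke_word R m (w @ t) \<otimes>\<^bsub>hecke_algebra R m\<^esub> hecke_word R m [j] =
      hecke_word R m ((w @ t) @ [j])"
    by (intro hecke_word_mult wt)
  ultimately have "hecke_class R n m (w @ t) = hecke_class R n m ((w @ t) @ [j])"
    by (intro hecke_class_eqI) simp
  then show ?case using snoc by simp
qed simp

lemma hecke_id_class: "hecke_id R n = hecke_class R n n []"
  by (simp add: hecke_id_def hecke_class_def hecke_algebra_one)

section \<open>Composition of morphisms as concatenation of words\<close>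

lemma hecke_hom_equiv_words:
  assumes "(a, b) \<in> hecke_hom_equiv R n m"
  shows "a \<in> hecke_word R m ` lists {1..<m}" "b \<in> hecke_word R m ` lists {1..<m}"
  using assms equiv_type[OF hecke_hom_equiv_equiv[of m n]] by (auto simp: hecke_monoid_words)

lemma hecke_hom_equiv_post:
  assumes "(a, b) \<in> hecke_hom_equiv R n m" "m \<le> l" "v \<in> lists {1..<l}"
  shows "hecke_hom_equiv R n l `` {hecke_word R l v \<otimes>\<^bsub>hecke_algebra R l\<^esub> hecke_incl R l a} =
    hecke_hom_equiv R n l `` {hecke_word R l v \<otimes>\<^bsub>hecke_algebra R l\<^esub> hecke_incl R l b}"
  using assms(1)
proof (induction rule: hecke_hom_equiv.induct)
  case (gen x j)
  then obtain w where w: "w \<in> lists {1..<m}" "x = hecke_word R m w"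
    by (auto simp: hecke_monoid_words)
  have wj: "w @ [j] \<in> lists {1..<m}" and j: "[j] \<in> lists {n + 1..<l}"
    and vw: "v @ w \<in> lists {1..<l}" "v @ w @ [j] \<in> lists {1..<l}" and wl: "w \<in> lists {1..<l}"
    using gen(2) w(1) assms(2,3) by (auto simp: in_lists_conv_set)
  have "x \<otimes>\<^bsub>hecke_algebra R m\<^esub> hecke_word R m [j] = hecke_word R m (w @ [j])"
    unfolding w(2) using w(1) wj by (intro hecke_word_mult) auto
  then show ?case
    using hecke_class_append[OF vw(1) j] vw wl assms(3)
      hecke_incl_word[OF assms(2) w(1)] hecke_incl_word[OF assms(2) wj]
    by (simp add: w(2) hecke_word_mult hecke_class_def)
qed simp_all

text \<open>A trailing letter \<open>j > m\<close> of the outer factor commutes with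
  \<open>u\<close>, whose letters lie below \<open>m\<close>. Once moved to the end it is a dummy
  letter for \<open>n\<close> as well, because \<open>n \<le> m\<close>.\<close>

lemma hecke_hom_equiv_pre:
  assumes "(a, b) \<in> hecke_hom_equiv R m l" "n \<le> m" "m \<le> l" "u \<in> lists {1..<m}"
  shows "hecke_hom_equiv R n l `` {a \<otimes>\<^bsub>hecke_algebra R l\<^esub> hecke_word R l u} =
    hecke_hom_equiv R n l `` {b \<otimes>\<^bsub>hecke_algebra R l\<^esub> hecke_word R l u}"
  using assms(1)
proof (induction rule: hecke_hom_equiv.induct)
  case (gen x j)
  then obtain w where w: "w \<in> lists {1..<l}" "x = hecke_word R l w"
    by (auto simp: hecke_monoid_words)
  have wj: "w @ [j] \<in> lists {1..<l}" and j: "[j] \<in> lists {n + 1..<l}"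
    and u: "u \<in> lists {1..<l}"
    using gen(2) w(1) assms(2-4) by (auto simp: in_lists_conv_set)
  have "word_eq True ((w @ [j]) @ u) (w @ (u @ [j]))"
    using gen(2) assms(4) word_eq_append[OF word_eq.refl word_eq_commute[of "[j]" u True], of w]
    by (fastforce simp: in_lists_conv_set)
  then have "hecke_class R n l ((w @ [j]) @ u) = hecke_class R n l ((w @ u) @ [j])"
    using hecke_class_cong[of "(w @ [j]) @ u"] wj u by simp
  also have "\<dots> = hecke_class R n l (w @ u)"
    using w u j by (intro hecke_class_append) auto
  finally show ?case
    using w wj u by (simp add: hecke_word_mult hecke_class_def)
qed simp_all

lemma hecke_comp_class:
  assumes "n \<le> m" "m \<le> l" "v \<in> lists {1..<l}" "w \<in> lists {1..<m}"
  shows "hecke_comp R n l (hecke_class R m l v) (hecke_class R n m w) = hecke_class R n l (v @ w)"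
proof -
  have wl: "w \<in> lists {1..<l}" using assms(2,4) by (auto simp: in_lists_conv_set)
  have "hecke_word R l v \<in> hecke_monoid R l" "hecke_word R m w \<in> hecke_monoid R m"
    unfolding hecke_monoid_words using assms(3,4) by (simp_all only: imageI)
  then have refl: "hecke_word R l v \<in> hecke_class R m l v" "hecke_word R m w \<in> hecke_class R n m w"
    by (simp_all add: hecke_class_def hecke_hom_equiv.refl)
  have "hecke_hom_equiv R n l `` {y \<otimes>\<^bsub>hecke_algebra R l\<^esub> hecke_incl R l x} =
      hecke_class R n l (v @ w)"
    if y: "y \<in> hecke_class R m l v" and x: "x \<in> hecke_class R n m w" for x y
  proof -
    have yv: "(hecke_word R l v, y) \<in> hecke_hom_equiv R m l"
      and xw: "(hecke_word R m w, x) \<in> hecke_hom_equiv R n m"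
      using x y by (simp_all add: hecke_class_def)
    obtain u where u: "u \<in> lists {1..<m}" "x = hecke_word R m u"
      using hecke_hom_equiv_words(2)[OF xw] by blast
    have "hecke_hom_equiv R n l `` {y \<otimes>\<^bsub>hecke_algebra R l\<^esub> hecke_incl R l x} =
        hecke_hom_equiv R n l `` {hecke_word R l v \<otimes>\<^bsub>hecke_algebra R l\<^esub> hecke_incl R l x}"
      unfolding u(2) hecke_incl_word[OF assms(2) u(1)]
      by (rule hecke_hom_equiv_pre[OF yv assms(1,2) u(1), symmetric])
    also have "\<dots> = hecke_hom_equiv R n l ``
        {hecke_word R l v \<otimes>\<^bsub>hecke_algebra R l\<^esub> hecke_incl R l (hecke_word R m w)}"
      by (rule hecke_hom_equiv_post[OF xw assms(2,3), symmetric])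
    also have "\<dots> = hecke_class R n l (v @ w)"
      using assms(3) wl
      by (simp add: hecke_incl_word[OF assms(2,4)] hecke_word_mult hecke_class_def)
    finally show ?thesis .
  qed
  with refl show ?thesis
    unfolding hecke_comp_def by blast
qed

end

section \<open>Divisibility of order-preserving injections\<close>

text \<open>Induction on the length. \<open>U\<close> is a finite set of tails covering the tails of
  all lists in \<open>S\<close>, and \<open>f\<close> picks one head for each. Lists whose head is
  at least all these heads are covered by \<open>U\<close>; each of the finitely many smaller heads
  \<open>h\<close> gets its own covering set \<open>T h\<close>.\<close>

lemma dickson:
  fixes S :: "nat list set"
  assumes "\<And>xs. xs \<in> S \<Longrightarrow> length xs = n"
  shows "\<exists>T. finite T \<and> T \<subseteq> S \<and> (\<forall>xs\<in>S. \<exists>ys\<in>T. list_all2 (\<le>) ys xs)"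
  using assms
proof (induction n arbitrary: S)
  case 0
  then have "S \<subseteq> {[]}" by auto
  then show ?case
    by (intro exI[of _ S]) (auto intro: finite_subset)
next
  case (Suc n)
  have head: "\<exists>T. finite T \<and> T \<subseteq> {ys. h # ys \<in> S} \<and>
      (\<forall>xs\<in>{ys. h # ys \<in> S}. \<exists>ys\<in>T. list_all2 (\<le>) ys xs)" for h
  proof (rule Suc.IH)
    fix ys assume "ys \<in> {ys. h # ys \<in> S}"
    then have "h # ys \<in> S" by blast
    from Suc.prems[OF this] show "length ys = n" by simp
  qed
  then have "\<exists>T. \<forall>h. finite (T h) \<and> T h \<subseteq> {ys. h # ys \<in> S} \<and>
      (\<forall>xs\<in>{ys. h # ys \<in> S}. \<exists>ys\<in>T h. list_all2 (\<le>) ys xs)"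
    by (intro choice allI)
  then obtain T where T: "\<forall>h. finite (T h) \<and> T h \<subseteq> {ys. h # ys \<in> S} \<and>
      (\<forall>xs\<in>{ys. h # ys \<in> S}. \<exists>ys\<in>T h. list_all2 (\<le>) ys xs)" ..
  have "\<exists>T. finite T \<and> T \<subseteq> {ys. \<exists>h. h # ys \<in> S} \<and>
      (\<forall>xs\<in>{ys. \<exists>h. h # ys \<in> S}. \<exists>ys\<in>T. list_all2 (\<le>) ys xs)"
  proof (rule Suc.IH)
    fix ys assume "ys \<in> {ys. \<exists>h. h # ys \<in> S}"
    then obtain h where "h # ys \<in> S" by blast
    from Suc.prems[OF this] show "length ys = n" by simp
  qed
  then obtain U where U: "finite U" "\<And>ys. ys \<in> U \<Longrightarrow> \<exists>h. h # ys \<in> S"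
    "\<And>h xs. h # xs \<in> S \<Longrightarrow> \<exists>ys\<in>U. list_all2 (\<le>) ys xs"
    by blast
  from U(2) obtain f where f: "\<And>ys. ys \<in> U \<Longrightarrow> f ys # ys \<in> S" by metis
  \<comment> \<open>The inserted \<open>0\<close> keeps the maximum defined when \<open>U\<close> is
    empty.\<close>
  define M where "M = Max (insert 0 (f ` U))"
  have M: "f ys \<le> M" if "ys \<in> U" for ys
    using that U(1) by (auto simp: M_def)
  let ?T = "(\<lambda>ys. f ys # ys) ` U \<union> (\<Union>h\<in>{..<M}. (#) h ` T h)"
  have cover: "\<exists>ys\<in>?T. list_all2 (\<le>) ys xs" if xs: "xs \<in> S" for xs
  proof -
    from Suc.prems[OF xs] obtain h zs where hz: "xs = h # zs" by (cases xs) auto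
    show ?thesis
    proof (cases "h < M")
      case True
      obtain ys where "ys \<in> T h" "list_all2 (\<le>) ys zs"
        using T[rule_format, of h] xs hz by auto
      with True hz show ?thesis by (intro bexI[of _ "h # ys"]) auto
    next
      case False
      obtain ys where "ys \<in> U" "list_all2 (\<le>) ys zs" using U(3) xs hz by blast
      moreover from this(1) have "f ys \<le> h" using M[of ys] False by simp
      ultimately show ?thesis using hz by (intro bexI[of _ "f ys # ys"]) auto
    qed
  qed
  moreover have "?T \<subseteq> S"
  proof
    fix xs assume "xs \<in> ?T"
    then consider ys where "ys \<in> U" "xs = f ys # ys" | h ys where "ys \<in> T h" "xs = h # ys"
      by auto
    then show "xs \<in> S"
    proof cases
      case 1
      then show ?thesis using f by simp
    next
      case 2
      then show ?thesis using T[rule_format, of h] by auto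
    qed
  qed
  moreover have "finite ?T"
    using U(1) T[rule_format] by (intro finite_UnI finite_UN_I finite_imageI finite_lessThan) simp_all
  ultimately show ?case
    using cover by (intro exI[of _ ?T] conjI ballI)
qed

text \<open>The gap sequence identifies the divisibility order on order-preserving injections with the
  componentwise order on \<open>\<nat>\<^sup>n\<^sup>+\<^sup>1\<close>.\<close>

fun gaps :: "nat \<Rightarrow> nat \<Rightarrow> nat list \<Rightarrow> nat list" where
  "gaps b m [] = [m - b]"
| "gaps b m (x # xs) = (x - Suc b) # gaps x m xs"

lemma length_gaps [simp]: "length (gaps b m xs) = Suc (length xs)"
  by (induction xs arbitrary: b) auto

lemma gaps_Suc: "gaps (Suc b) (Suc m) (map Suc xs) = gaps b m xs"
  by (induction xs arbitrary: b) auto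

lemma gaps_inject:
  assumes "gaps b m xs = gaps b m' ys" "length xs = length ys"
    and "sorted_wrt (<) (b # xs)" "sorted_wrt (<) (b # ys)" "\<forall>x\<in>set (b # xs). x \<le> m"
      "\<forall>y\<in>set (b # ys). y \<le> m'"
  shows "m = m' \<and> xs = ys"
  using assms(2,1,3-)
  by (induction xs ys arbitrary: b rule: list_induct2) (auto, (metis Suc_leI diff_add_inverse2 le_add_diff_inverse)+)

text \<open>The new omitted value is placed directly after the entry that opens gap
  \<open>i\<close>, or after \<open>b\<close> for the first gap, so that no other gap
  changes.\<close>

lemma gaps_face:
  assumes "sorted_wrt (<) (b # xs)" "\<forall>x\<in>set (b # xs). x \<le> m" "i \<le> length xs"
  shows "\<exists>c. b < c \<and> c \<le> Suc m \<and>
    gaps b (Suc m) (map (face c) xs) = (gaps b m xs)[i := Suc (gaps b m xs ! i)]"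
  using assms
proof (induction xs arbitrary: b i)
  case Nil
  then show ?case by (intro exI[of _ "Suc b"]) (auto simp: Suc_diff_le)
next
  case (Cons x xs)
  show ?case
  proof (cases i)
    case 0
    have eq: "map (face (Suc b)) xs = map Suc xs" "face (Suc b) x = Suc x"
      using Cons.prems(1) by (auto simp: face_def)
    have "gaps b (Suc m) (map (face (Suc b)) (x # xs)) = (x - b) # gaps x m xs"
      unfolding list.map eq gaps.simps gaps_Suc by simp
    moreover have "x - b = Suc (x - Suc b)" using Cons.prems(1) by auto
    ultimately show ?thesis
      using Cons.prems 0 by (intro exI[of _ "Suc b"]) auto
  next
    case (Suc j)
    then obtain c where c: "x < c" "c \<le> Suc m"
      "gaps x (Suc m) (map (face c) xs) = (gaps x m xs)[j := Suc (gaps x m xs ! j)]"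
      using Cons.IH[of x j] Cons.prems by auto
    moreover have "face c x = x" using c(1) by (simp add: face_def)
    ultimately show ?thesis
      using Cons.prems Suc by (intro exI[of _ c]) auto
  qed
qed

text \<open>The sizes of the targets are carried along because a list does not determine its
  codomain.\<close>

inductive oi_divides :: "nat \<Rightarrow> nat list \<Rightarrow> nat \<Rightarrow> nat list \<Rightarrow> bool" where
  refl: "oi_divides m xs m xs"
| step: "c \<in> {1..Suc m} \<Longrightarrow> oi_divides (Suc m) (map (face c) xs) m' ys \<Longrightarrow> oi_divides m xs m' ys"

lemma oi_divides_gaps:
  assumes "xs \<in> oi n m" "ys \<in> oi n m'" "list_all2 (\<le>) (gaps 0 m xs) (gaps 0 m' ys)"
  shows "oi_divides m xs m' ys"
  using assms
\<comment> \<open>The gaps of an injection add up to the number of omitted values, so the measure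
  counts the faces still to be inserted.\<close>
proof (induction "sum_list (gaps 0 m' ys) - sum_list (gaps 0 m xs)" arbitrary: m xs rule: less_induct)
  case less
  let ?x = "gaps 0 m xs" and ?y = "gaps 0 m' ys"
  have s: "sorted_wrt (<) (0 # xs)" "\<forall>x\<in>set (0 # xs). x \<le> m"
    "sorted_wrt (<) (0 # ys)" "\<forall>x\<in>set (0 # ys). x \<le> m'" "length xs = length ys"
    using less.prems by (auto simp: oi_def subset_iff Suc_le_eq)
  show ?case
  proof (cases "?x = ?y")
    case True
    then show ?thesis using gaps_inject[of 0 m xs m' ys] s by (auto intro: oi_divides.refl)
  next
    case False
    have le: "?x ! i \<le> ?y ! i" if "i < length ?x" for i
      using that less.prems(3) by (auto simp: list_all2_conv_all_nth)
    from False obtain i where i: "i < length ?x" "?x ! i < ?y ! i"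
      using le s(5) by (metis length_gaps le_neq_implies_less nth_equalityI)
    then have "i \<le> length xs" by simp
    from gaps_face[OF s(1,2) this] obtain c where c: "0 < c" "c \<le> Suc m"
      "gaps 0 (Suc m) (map (face c) xs) = ?x[i := Suc (?x ! i)]" by blast
    let ?z = "?x[i := Suc (?x ! i)]"
    have z: "list_all2 (\<le>) ?z ?y"
      using le i s(5) by (auto simp: list_all2_conv_all_nth nth_list_update)
    have "sum_list ?z = Suc (sum_list ?x)"
    proof -
      have "sum_list ?x \<ge> ?x ! i" using i(1) by (simp add: elem_le_sum_list)
      then show ?thesis using i(1) by (simp add: sum_list_update)
    qed
    moreover have "sum_list ?z \<le> sum_list ?y"
      using z by (induction rule: list_all2_induct) auto
    ultimately have "sum_list ?y - sum_list ?z < sum_list ?y - sum_list ?x" by simp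
    with c z have "oi_divides (Suc m) (map (face c) xs) m' ys"
      using less.prems oi_face[of xs n m c] by (intro less.hyps) auto
    moreover have "c \<in> {1..Suc m}" using c by simp
    ultimately show ?thesis by (rule oi_divides.step[rotated])
  qed
qed

text \<open>Dickson's lemma carried back from gap sequences to injections with a common source;
  \<open>P\<close> will describe the leading injections of a submodule at one generator.\<close>

lemma oi_finite_basis:
  assumes "\<And>m xs. P m xs \<Longrightarrow> xs \<in> oi n m"
  shows "\<exists>T. finite T \<and> (\<forall>(m, xs)\<in>T. P m xs) \<and>
    (\<forall>m xs. P m xs \<longrightarrow> (\<exists>(m', ys)\<in>T. oi_divides m' ys m xs))"
proof -
  let ?S = "{gaps 0 m xs | m xs. P m xs}"
  have "length g = Suc n" if "g \<in> ?S" for g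
  proof -
    from that obtain m xs where "g = gaps 0 m xs" "P m xs" by blast
    with assms[of m xs] show ?thesis by (simp add: oi_def)
  qed
  then have "\<exists>T. finite T \<and> T \<subseteq> ?S \<and> (\<forall>xs\<in>?S. \<exists>ys\<in>T. list_all2 (\<le>) ys xs)"
    by (rule dickson)
  then obtain T where T: "finite T" "T \<subseteq> ?S"
    "\<forall>xs\<in>?S. \<exists>ys\<in>T. list_all2 (\<le>) ys xs" by (elim exE conjE)
  have "\<forall>g\<in>T. \<exists>p. g = gaps 0 (fst p) (snd p) \<and> P (fst p) (snd p)"
  proof
    fix g assume "g \<in> T"
    then obtain m xs where "g = gaps 0 m xs" "P m xs" using T(2) by auto
    then show "\<exists>p. g = gaps 0 (fst p) (snd p) \<and> P (fst p) (snd p)"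
      by (intro exI[of _ "(m, xs)"]) simp
  qed
  then obtain f where f: "\<forall>g\<in>T. g = gaps 0 (fst (f g)) (snd (f g)) \<and> P (fst (f g)) (snd (f g))"
    by (rule bchoice[THEN exE])
  have "\<exists>(m', ys)\<in>f ` T. oi_divides m' ys m xs" if "P m xs" for m xs
  proof -
    from that have "gaps 0 m xs \<in> ?S" by auto
    from bspec[OF T(3) this]
    obtain g where g: "g \<in> T" "list_all2 (\<le>) g (gaps 0 m xs)" by (rule bexE)
    then have "oi_divides (fst (f g)) (snd (f g)) m xs"
      using bspec[OF f g(1)] that assms g(2)
      by (intro oi_divides_gaps[of _ n]) simp_all
    with g(1) show ?thesis by (intro bexI[of _ "f g"]) (auto simp: case_prod_beta)
  qed
  then show ?thesis
    using T(1) f by (intro exI[of _ "f ` T"] conjI allI impI) (simp_all add: case_prod_beta)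
qed

section \<open>Linear spans\<close>

inductive_set lin_span :: "('k, 'r) ring_scheme \<Rightarrow> ('k, 'v, 'p) module_scheme \<Rightarrow> 'v set \<Rightarrow> 'v set"
  for K and M and B where
  zero: "\<zero>\<^bsub>M\<^esub> \<in> lin_span K M B"
| add: "c \<in> carrier K \<Longrightarrow> b \<in> B \<Longrightarrow> x \<in> lin_span K M B \<Longrightarrow> c \<odot>\<^bsub>M\<^esub> b \<oplus>\<^bsub>M\<^esub> x \<in> lin_span K M B"

lemma (in abelian_group) add_minus_add_left:
  assumes "a \<in> carrier G" "x \<in> carrier G" "y \<in> carrier G"
  shows "(a \<oplus> x) \<ominus> (a \<oplus> y) = x \<ominus> y"
proof -
  have "(a \<oplus> x) \<ominus> (a \<oplus> y) = (x \<oplus> a) \<oplus> (\<ominus> a \<oplus> \<ominus> y)"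
    using assms by (simp add: a_minus_def minus_add a_comm)
  also have "\<dots> = x \<ominus> y"
    using assms by (simp add: a_minus_def a_assoc r_neg2)
  finally show ?thesis .
qed

context module
begin

lemma lin_span_closed:
  assumes "B \<subseteq> carrier M" "x \<in> lin_span R M B"
  shows "x \<in> carrier M"
  using assms(2) by induction (use assms(1) in auto)

lemma lin_span_add:
  assumes "B \<subseteq> carrier M" "x \<in> lin_span R M B" "y \<in> lin_span R M B"
  shows "x \<oplus>\<^bsub>M\<^esub> y \<in> lin_span R M B"
  using assms(2)
proof induction
  case zero
  then show ?case using assms lin_span_closed by simp
next
  case (add c b x)
  have "c \<odot>\<^bsub>M\<^esub> b \<oplus>\<^bsub>M\<^esub> x \<oplus>\<^bsub>M\<^esub> y = c \<odot>\<^bsub>M\<^esub> b \<oplus>\<^bsub>M\<^esub> (x \<oplus>\<^bsub>M\<^esub> y)"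
    using add assms lin_span_closed by (intro M.a_assoc) auto
  then show ?case using add by (simp add: lin_span.add)
qed

lemma lin_span_smult:
  assumes "B \<subseteq> carrier M" "a \<in> carrier R" "x \<in> lin_span R M B"
  shows "a \<odot>\<^bsub>M\<^esub> x \<in> lin_span R M B"
  using assms(3)
proof induction
  case zero
  then show ?case using assms by (simp add: lin_span.zero)
next
  case (add c b x)
  then have "a \<odot>\<^bsub>M\<^esub> (c \<odot>\<^bsub>M\<^esub> b \<oplus>\<^bsub>M\<^esub> x) = (a \<otimes> c) \<odot>\<^bsub>M\<^esub> b \<oplus>\<^bsub>M\<^esub> a \<odot>\<^bsub>M\<^esub> x"
    using assms(1,2) lin_span_closed[OF assms(1)] smult_assoc1[of a c b]
    by (subst smult_r_distr) auto
  then show ?case using add assms(2) by (simp add: lin_span.add)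
qed

lemma lin_span_base:
  assumes "B \<subseteq> carrier M" "b \<in> B"
  shows "b \<in> lin_span R M B"
  using lin_span.add[OF R.one_closed assms(2) lin_span.zero[of M R]] assms by auto

lemma submodule_zero:
  assumes "submodule H R M"
  shows "\<zero>\<^bsub>M\<^esub> \<in> H"
proof -
  obtain x where "x \<in> H" using submoduleE(2)[OF assms] by auto
  moreover from this have "x \<in> carrier M" using submoduleE(1)[OF assms] by auto
  ultimately show ?thesis
    using submoduleE(4)[OF assms R.zero_closed, of x] by simp
qed

lemma submodule_diff:
  assumes "submodule H R M" "x \<in> H" "y \<in> H"
  shows "x \<ominus>\<^bsub>M\<^esub> y \<in> H"
  using submoduleE(3,5)[OF assms(1)] assms(2,3) by (simp add: a_minus_def)

lemma lin_span_submodule: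
  assumes "B \<subseteq> carrier M"
  shows "submodule (lin_span R M B) R M"
proof (rule submoduleI)
  show "lin_span R M B \<subseteq> carrier M" using lin_span_closed[OF assms] by blast
  show "\<zero>\<^bsub>M\<^esub> \<in> lin_span R M B" by (rule lin_span.zero)
  show "\<ominus>\<^bsub>M\<^esub> x \<in> lin_span R M B" if "x \<in> lin_span R M B" for x
    using lin_span_smult[OF assms R.a_inv_closed[OF R.one_closed] that]
      lin_span_closed[OF assms that] by (simp add: smult_l_minus)
qed (auto intro: lin_span_add[OF assms] lin_span_smult[OF assms])

lemma lin_span_insert:
  assumes "b \<in> carrier M" "B \<subseteq> carrier M" "x \<in> lin_span R M (insert b B)"
  shows "\<exists>c\<in>carrier R. \<exists>y\<in>lin_span R M B. x = c \<odot>\<^bsub>M\<^esub> b \<oplus>\<^bsub>M\<^esub> y"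
  using assms(3)
proof induction
  case zero
  have "\<zero>\<^bsub>M\<^esub> = \<zero> \<odot>\<^bsub>M\<^esub> b \<oplus>\<^bsub>M\<^esub> \<zero>\<^bsub>M\<^esub>" using assms(1) by simp
  then show ?case using lin_span.zero R.zero_closed by blast
next
  case (add c a x)
  then obtain d y where dy: "d \<in> carrier R" "y \<in> lin_span R M B" "x = d \<odot>\<^bsub>M\<^esub> b \<oplus>\<^bsub>M\<^esub> y" by blast
  have y: "y \<in> carrier M" using lin_span_closed[OF assms(2) dy(2)] .
  show ?case
  proof (cases "a = b")
    case True
    have "c \<odot>\<^bsub>M\<^esub> a \<oplus>\<^bsub>M\<^esub> x = (c \<oplus> d) \<odot>\<^bsub>M\<^esub> b \<oplus>\<^bsub>M\<^esub> y"
      using add(1) dy(1,3) y assms(1) True by (simp add: smult_l_distr M.a_assoc)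
    then show ?thesis using add(1) dy(1,2) by blast
  next
    case False
    then have a: "a \<in> B" "a \<in> carrier M" using add(2) assms(2) by auto
    have "c \<odot>\<^bsub>M\<^esub> a \<oplus>\<^bsub>M\<^esub> x = d \<odot>\<^bsub>M\<^esub> b \<oplus>\<^bsub>M\<^esub> (c \<odot>\<^bsub>M\<^esub> a \<oplus>\<^bsub>M\<^esub> y)"
      using add(1) dy(1,3) y assms(1) a(2) by (simp add: M.a_lcomm)
    moreover have "c \<odot>\<^bsub>M\<^esub> a \<oplus>\<^bsub>M\<^esub> y \<in> lin_span R M B"
      using add(1) a(1) dy(2) by (rule lin_span.add)
    ultimately show ?thesis using dy(1) by blast
  qed
qed

end

lemma lin_span_image:
  assumes "module K M" "module K M'" "h \<in> linear_maps K M M'" "B \<subseteq> carrier M" "B' \<subseteq> carrier M'"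
    and "\<And>b. b \<in> B \<Longrightarrow> h b \<in> lin_span K M' B'" "x \<in> lin_span K M B"
  shows "h x \<in> lin_span K M' B'"
  using assms(7)
proof induction
  interpret M: module K M by fact
  interpret M': module K M' by fact
  {
    case zero
    have "\<forall>c\<in>carrier K. \<forall>x\<in>carrier M. h (c \<odot>\<^bsub>M\<^esub> x) = c \<odot>\<^bsub>M'\<^esub> h x" "h \<zero>\<^bsub>M\<^esub> \<in> carrier M'"
      using assms(3) by (auto simp: linear_maps_def)
    from bspec[OF bspec[OF this(1) M.R.zero_closed] M.zero_closed] this(2)
    have "h \<zero>\<^bsub>M\<^esub> = \<zero>\<^bsub>M'\<^esub>" by simp
    then show ?case by (simp add: lin_span.zero)
  next
    case (add c b x)
    then have "b \<in> carrier M" "x \<in> carrier M"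
      using assms(4) M.lin_span_closed[OF assms(4)] by auto
    then have "h (c \<odot>\<^bsub>M\<^esub> b \<oplus>\<^bsub>M\<^esub> x) = c \<odot>\<^bsub>M'\<^esub> h b \<oplus>\<^bsub>M'\<^esub> h x"
      using assms(3) add(1) by (simp add: linear_maps_def)
    then show ?case
      using add M'.lin_span_add[OF assms(5)] M'.lin_span_smult[OF assms(5)] assms(6) by simp
  }
qed

text \<open>Reduction of leading terms: if each leading index of \<open>N\<close> also occurs in
  \<open>N'\<close>, an element of \<open>N\<close> can be lowered step by step by elements of
  \<open>N'\<close>. The family \<open>e\<close> may be linearly dependent; a leading index is only
  asserted for some expression of a vector, so no uniqueness enters.\<close>

lemma leading_index_reduction:
  fixes I :: "'i :: linorder set"
  assumes "field K" "module K M" "submodule N K M" "submodule N' K M" "N' \<subseteq> N"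
    and "finite I" "\<And>i. i \<in> I \<Longrightarrow> e i \<in> carrier M" "carrier M = lin_span K M (e ` I)"
    and lead: "\<And>i p q. i \<in> I \<Longrightarrow> p \<in> N \<Longrightarrow> q \<in> lin_span K M (e ` {j\<in>I. j < i}) \<Longrightarrow> p = e i \<oplus>\<^bsub>M\<^esub> q \<Longrightarrow>
      \<exists>p'\<in>N'. \<exists>q'\<in>lin_span K M (e ` {j\<in>I. j < i}). p' = e i \<oplus>\<^bsub>M\<^esub> q'"
  shows "N \<subseteq> N'"
proof -
  interpret field K by fact
  interpret M: module K M by fact
  \<comment> \<open>For downward closed \<open>S\<close>, removing the greatest element
    \<open>i\<close> leaves exactly the indices below \<open>i\<close>, which matches the span in
    \<open>lead\<close>.\<close>
  have "N \<inter> lin_span K M (e ` S) \<subseteq> N'"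
    if "finite S" "S \<subseteq> I" "\<forall>i\<in>S. \<forall>j\<in>I. j < i \<longrightarrow> j \<in> S" for S
    using that
  proof (induction S rule: finite_linorder_max_induct)
    case empty
    have "lin_span K M {} = {\<zero>\<^bsub>M\<^esub>}"
      by (auto elim: lin_span.cases intro: lin_span.zero)
    then show ?case using M.submodule_zero[OF assms(4)] by auto
  next
    case (insert i A)
    have A: "A = {j\<in>I. j < i}"
      using insert by auto
    have A': "N \<inter> lin_span K M (e ` A) \<subseteq> N'"
      using insert.prems by (intro insert.IH) (auto simp: A)
    have i: "i \<in> I" "e i \<in> carrier M" using insert.prems assms(7) by auto
    have eA: "e ` A \<subseteq> carrier M" using assms(7) A by auto
    note sub = M.lin_span_submodule[OF eA]
    show ?case
    proof
      fix x assume x: "x \<in> N \<inter> lin_span K M (e ` insert i A)"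
      then obtain c y where c: "c \<in> carrier K" and y: "y \<in> lin_span K M (e ` A)"
        and xcy: "x = c \<odot>\<^bsub>M\<^esub> e i \<oplus>\<^bsub>M\<^esub> y"
        using M.lin_span_insert[OF i(2) eA, of x] by auto
      have yM: "y \<in> carrier M" by (rule M.lin_span_closed[OF eA y])
      show "x \<in> N'"
      proof (cases "c = \<zero>\<^bsub>K\<^esub>")
        case True
        then show ?thesis using A' x y xcy i(2) yM by auto
      next
        case False
        \<comment> \<open>Dividing by \<open>c\<close> gives the leading coefficient one that
          \<open>lead\<close> requires. Subtracting \<open>c\<close> times the element
          \<open>p\<close> of \<open>N'\<close> then cancels \<open>e i\<close> and leaves an
          element of \<open>N\<close> in the smaller span.\<close>
        then have "c \<in> Units K" using c by (simp add: field_Units)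
        then have ic: "inv\<^bsub>K\<^esub> c \<in> carrier K" "inv\<^bsub>K\<^esub> c \<otimes>\<^bsub>K\<^esub> c = \<one>\<^bsub>K\<^esub>" by auto
        have "inv\<^bsub>K\<^esub> c \<odot>\<^bsub>M\<^esub> x = e i \<oplus>\<^bsub>M\<^esub> inv\<^bsub>K\<^esub> c \<odot>\<^bsub>M\<^esub> y"
          using c ic i(2) yM unfolding xcy
          by (simp add: M.smult_r_distr M.smult_assoc1[symmetric])
        moreover have "inv\<^bsub>K\<^esub> c \<odot>\<^bsub>M\<^esub> x \<in> N" using x ic M.submoduleE(4)[OF assms(3)] by auto
        moreover have "inv\<^bsub>K\<^esub> c \<odot>\<^bsub>M\<^esub> y \<in> lin_span K M (e ` A)"
          using ic y by (intro M.lin_span_smult[OF eA])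
        ultimately obtain p q where p: "p \<in> N'" and q: "q \<in> lin_span K M (e ` A)"
          and pq: "p = e i \<oplus>\<^bsub>M\<^esub> q"
          using lead[OF i(1), of "inv\<^bsub>K\<^esub> c \<odot>\<^bsub>M\<^esub> x" "inv\<^bsub>K\<^esub> c \<odot>\<^bsub>M\<^esub> y"] unfolding A by blast
        have qM: "q \<in> carrier M" by (rule M.lin_span_closed[OF eA q])
        have cp: "c \<odot>\<^bsub>M\<^esub> p \<in> N'" using M.submoduleE(4)[OF assms(4) c p] .
        have cpM: "c \<odot>\<^bsub>M\<^esub> p \<in> carrier M" "x \<in> carrier M"
          using cp x M.submoduleE(1)[OF assms(3)] assms(5) by auto
        have "x \<ominus>\<^bsub>M\<^esub> c \<odot>\<^bsub>M\<^esub> p = y \<ominus>\<^bsub>M\<^esub> c \<odot>\<^bsub>M\<^esub> q"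
          using c i(2) yM qM unfolding xcy pq
          by (simp add: M.smult_r_distr M.add_minus_add_left)
        also have "\<dots> \<in> lin_span K M (e ` A)"
          using y q c by (intro M.submodule_diff[OF sub] M.lin_span_smult[OF eA])
        finally have "x \<ominus>\<^bsub>M\<^esub> c \<odot>\<^bsub>M\<^esub> p \<in> N'"
          using A' x cp assms(5) M.submodule_diff[OF assms(3)] by blast
        then have "(x \<ominus>\<^bsub>M\<^esub> c \<odot>\<^bsub>M\<^esub> p) \<oplus>\<^bsub>M\<^esub> c \<odot>\<^bsub>M\<^esub> p \<in> N'"
          using cp by (intro M.submoduleE(5)[OF assms(4)])
        then show ?thesis
          using cpM by (simp add: a_minus_def M.a_assoc M.l_neg)
      qed
    qed
  qed
  from this[of I] show ?thesis
    using assms(6,8) M.submoduleE(1)[OF assms(3)] by auto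
qed

section \<open>Modules over order-preserving injections\<close>

lemma face_less: "x < y \<Longrightarrow> face c x < face c y"
  by (simp add: face_def)

text \<open>Strictness is the point: after a face map no lower term can tie with the leading
  one.\<close>

lemma map_face_less: "xs < ys \<Longrightarrow> map (face c) xs < map (face c) ys"
proof (induction xs arbitrary: ys)
  case Nil
  then show ?case by (cases ys) auto
next
  case (Cons x xs)
  then show ?case by (cases ys) (auto intro: face_less)
qed

lemma finite_oi: "finite (oi n m)"
proof (rule finite_subset)
  show "oi n m \<subseteq> {xs. set xs \<subseteq> {1..m} \<and> length xs = n}" by (auto simp: oi_def)
qed (rule finite_lists_length_eq, simp)

text \<open>This describes a quotient of a finite sum of principal modules over order-preserving
  injections without building the sum: generator \<open>i\<close> lives in degree
  \<open>ar i\<close>, and \<open>E i m xs\<close> is its image under \<open>xs\<close>.\<close>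

locale oi_module =
  fixes K :: "('k, 'r) ring_scheme" and V :: "nat \<Rightarrow> ('k, 'v, 'p) module_scheme"
    and D :: "nat \<Rightarrow> nat \<Rightarrow> 'v \<Rightarrow> 'v" and r :: nat and ar :: "nat \<Rightarrow> nat"
    and E :: "nat \<Rightarrow> nat \<Rightarrow> nat list \<Rightarrow> 'v"
  assumes field: "field K" and module: "module K (V m)"
    and D: "c \<in> {1..Suc m} \<Longrightarrow> D c m \<in> linear_maps K (V m) (V (Suc m))"
    and E: "i < r \<Longrightarrow> xs \<in> oi (ar i) m \<Longrightarrow> E i m xs \<in> carrier (V m)"
    and D_E: "c \<in> {1..Suc m} \<Longrightarrow> i < r \<Longrightarrow> xs \<in> oi (ar i) m \<Longrightarrow>
      D c m (E i m xs) = E i (Suc m) (map (face c) xs)"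
    and span: "carrier (V m) = lin_span K (V m) {E i m xs | i xs. i < r \<and> xs \<in> oi (ar i) m}"
begin

text \<open>The pair \<open>(i, xs)\<close> is encoded as \<open>i # xs\<close>, so that the lexicographic order on lists is a
  total order on indices that is preserved by the face maps.\<close>

definition indices :: "nat \<Rightarrow> nat list set" where
  "indices m = {i # xs | i xs. i < r \<and> xs \<in> oi (ar i) m}"

definition elem :: "nat \<Rightarrow> nat list \<Rightarrow> 'v" where
  "elem m k = E (hd k) m (tl k)"

definition lower :: "nat \<Rightarrow> nat list \<Rightarrow> 'v set" where
  "lower m k = lin_span K (V m) (elem m ` {j \<in> indices m. j < k})"

text \<open>A relation, not a function of \<open>p\<close>: as the spanning vectors may be
  dependent, \<open>p\<close> can have several leading indices. The leading coefficient is
  normalised to one.\<close>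

definition has_lead :: "'v set \<Rightarrow> nat \<Rightarrow> nat list \<Rightarrow> 'v \<Rightarrow> bool" where
  "has_lead H m k p \<longleftrightarrow> p \<in> H \<and> (\<exists>q\<in>lower m k. p = elem m k \<oplus>\<^bsub>V m\<^esub> q)"

lemma elem_closed: "k \<in> indices m \<Longrightarrow> elem m k \<in> carrier (V m)"
  by (auto simp: indices_def elem_def E)

lemma finite_indices: "finite (indices m)"
proof -
  have "indices m = (\<Union>i\<in>{..<r}. (#) i ` oi (ar i) m)" by (auto simp: indices_def)
  then show ?thesis by (simp add: finite_oi)
qed

lemma span_indices: "carrier (V m) = lin_span K (V m) (elem m ` indices m)"
proof -
  have "{E i m xs | i xs. i < r \<and> xs \<in> oi (ar i) m} = elem m ` indices m"
    by (force simp: indices_def elem_def image_iff)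
  with span[of m] show ?thesis by simp
qed

lemma has_lead_face:
  assumes c: "c \<in> {1..Suc m}" and i: "i < r" and xs: "xs \<in> oi (ar i) m"
    and p: "has_lead (H m) m (i # xs) p" and H: "\<And>v. v \<in> H m \<Longrightarrow> D c m v \<in> H (Suc m)"
  shows "has_lead (H (Suc m)) (Suc m) (i # map (face c) xs) (D c m p)"
proof -
  interpret M: module K "V m" by (rule module)
  let ?B = "elem m ` {j \<in> indices m. j < i # xs}"
  let ?C = "elem (Suc m) ` {j \<in> indices (Suc m). j < i # map (face c) xs}"
  have B: "?B \<subseteq> carrier (V m)" "?C \<subseteq> carrier (V (Suc m))" using elem_closed by auto
  from p obtain q where q: "q \<in> lower m (i # xs)" "p = elem m (i # xs) \<oplus>\<^bsub>V m\<^esub> q"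
    and "p \<in> H m" by (auto simp: has_lead_def)
  have "D c m b \<in> lin_span K (V (Suc m)) ?C" if "b \<in> ?B" for b
  proof -
    from that obtain j ys where j: "j < r" "ys \<in> oi (ar j) m" "j # ys < i # xs" "b = E j m ys"
      by (auto simp: indices_def elem_def)
    have "j # map (face c) ys < i # map (face c) xs"
      using j(3) by (auto intro: map_face_less)
    moreover have "j # map (face c) ys \<in> indices (Suc m)"
      using j oi_face[OF j(2) c] by (auto simp: indices_def)
    ultimately have "elem (Suc m) (j # map (face c) ys) \<in> ?C" by blast
    then have "E j (Suc m) (map (face c) ys) \<in> ?C" by (simp add: elem_def)
    then show ?thesis
      unfolding j(4) D_E[OF c j(1,2)] by (rule module.lin_span_base[OF module B(2)])
  qed
  then have Dq: "D c m q \<in> lower (Suc m) (i # map (face c) xs)"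
    using q(1) unfolding lower_def by (rule lin_span_image[OF module module D[OF c] B])
  have "q \<in> carrier (V m)" using q(1) M.lin_span_closed[OF B(1)] by (simp add: lower_def)
  then have "D c m p = D c m (elem m (i # xs)) \<oplus>\<^bsub>V (Suc m)\<^esub> D c m q"
    using D[OF c] E[OF i xs] unfolding q(2) by (simp add: linear_maps_def elem_def)
  then have "D c m p = elem (Suc m) (i # map (face c) xs) \<oplus>\<^bsub>V (Suc m)\<^esub> D c m q"
    by (simp add: elem_def D_E[OF c i xs])
  with Dq H[OF \<open>p \<in> H m\<close>] show ?thesis by (auto simp: has_lead_def)
qed

lemma has_lead_divides:
  assumes "oi_divides m xs m' ys" "i < r" "xs \<in> oi (ar i) m" "\<exists>p. has_lead (H m) m (i # xs) p"
    and H: "\<And>c m v. c \<in> {1..Suc m} \<Longrightarrow> v \<in> H m \<Longrightarrow> D c m v \<in> H (Suc m)"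
  shows "\<exists>p. has_lead (H m') m' (i # ys) p"
  using assms(1-4)
proof (induction rule: oi_divides.induct)
  case (step c m xs m' ys)
  from step.prems(3) obtain p where "has_lead (H m) m (i # xs) p" ..
  then have "has_lead (H (Suc m)) (Suc m) (i # map (face c) xs) (D c m p)"
    using step.hyps(1) step.prems H by (intro has_lead_face)
  then have "\<exists>p. has_lead (H (Suc m)) (Suc m) (i # map (face c) xs) p" ..
  then show ?case
    using oi_face[OF step.prems(2) step.hyps(1)] step.prems(1) by (intro step.IH)
qed

theorem noetherian:
  assumes N: "\<And>m. submodule (N m) K (V m)"
    "\<And>c m v. c \<in> {1..Suc m} \<Longrightarrow> v \<in> N m \<Longrightarrow> D c m v \<in> N (Suc m)"
  shows "\<exists>G. finite G \<and> G \<subseteq> (SIGMA m:UNIV. N m) \<and>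
    (\<forall>H. (\<forall>m. submodule (H m) K (V m) \<and> H m \<subseteq> N m) \<longrightarrow>
      (\<forall>c m v. c \<in> {1..Suc m} \<longrightarrow> v \<in> H m \<longrightarrow> D c m v \<in> H (Suc m)) \<longrightarrow>
      (\<forall>(m, v)\<in>G. v \<in> H m) \<longrightarrow> (\<forall>m. H m = N m))"
proof -
  \<comment> \<open>For fixed \<open>i\<close> these are the leading injections at generator
    \<open>i\<close>. The generators are treated separately because the finite basis lemma needs a
    common source size.\<close>
  define P where "P i m xs \<longleftrightarrow> i < r \<and> xs \<in> oi (ar i) m \<and> (\<exists>p. has_lead (N m) m (i # xs) p)"
    for i m xs
  have "\<exists>T. finite T \<and> (\<forall>(m, xs)\<in>T. P i m xs) \<and>
    (\<forall>m xs. P i m xs \<longrightarrow> (\<exists>(m', ys)\<in>T. oi_divides m' ys m xs))" for i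
    by (rule oi_finite_basis[of "P i" "ar i"]) (simp add: P_def)
  then have "\<exists>T. \<forall>i. finite (T i) \<and> (\<forall>(m, xs)\<in>T i. P i m xs) \<and>
    (\<forall>m xs. P i m xs \<longrightarrow> (\<exists>(m', ys)\<in>T i. oi_divides m' ys m xs))"
    by (intro choice allI)
  then obtain T where T: "\<forall>i. finite (T i) \<and> (\<forall>(m, xs)\<in>T i. P i m xs) \<and>
    (\<forall>m xs. P i m xs \<longrightarrow> (\<exists>(m', ys)\<in>T i. oi_divides m' ys m xs))" ..
  define p where "p i m xs = (SOME p. has_lead (N m) m (i # xs) p)" for i m xs
  have p: "has_lead (N m) m (i # xs) (p i m xs)" if "P i m xs" for i m xs
    using that unfolding P_def p_def by (intro someI_ex[of "has_lead (N m) m (i # xs)"]) simp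
  define G where "G = (\<Union>i\<in>{..<r}. (\<lambda>(m, xs). (m, p i m xs)) ` T i)"
  have "finite G"
    using T[rule_format] unfolding G_def by (intro finite_UN_I finite_imageI) simp_all
  moreover have "G \<subseteq> (SIGMA m:UNIV. N m)"
  proof
    fix x assume "x \<in> G"
    then obtain i m xs where x: "(m, xs) \<in> T i" "x = (m, p i m xs)"
      by (auto simp: G_def)
    from x(1) T have "P i m xs" by fastforce
    from p[OF this] show "x \<in> (SIGMA m:UNIV. N m)" by (simp add: x(2) has_lead_def)
  qed
  moreover have "H m = N m"
    if H: "\<And>m. submodule (H m) K (V m)" "\<And>m. H m \<subseteq> N m"
      "\<And>c m v. c \<in> {1..Suc m} \<Longrightarrow> v \<in> H m \<Longrightarrow> D c m v \<in> H (Suc m)"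
      and G: "\<forall>(m, v)\<in>G. v \<in> H m" for H m
  proof -
    have "N m \<subseteq> H m"
    proof (rule leading_index_reduction[OF field module N(1) H(1,2) finite_indices elem_closed span_indices])
      fix k q p'
      assume k: "k \<in> indices m" and "p' \<in> N m" and "q \<in> lin_span K (V m) (elem m ` {j \<in> indices m. j < k})"
        and "p' = elem m k \<oplus>\<^bsub>V m\<^esub> q"
      then have lead: "has_lead (N m) m k p'" by (auto simp: has_lead_def lower_def)
      from k obtain i xs where i: "k = i # xs" "i < r" "xs \<in> oi (ar i) m"
        by (auto simp: indices_def)
      with lead have "P i m xs" by (auto simp: P_def)
      with T[rule_format, of i] obtain m' ys where T': "(m', ys) \<in> T i" "oi_divides m' ys m xs"
        by blast
      have P: "P i m' ys" using T[rule_format, of i] T'(1) by auto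
      have "(m', p i m' ys) \<in> G" using T'(1) i(2) by (force simp: G_def)
      with G have "p i m' ys \<in> H m'" by auto
      with p[OF P] have "has_lead (H m') m' (i # ys) (p i m' ys)" by (simp add: has_lead_def)
      then have "\<exists>p. has_lead (H m') m' (i # ys) p" ..
      then have "\<exists>p. has_lead (H m) m (i # xs) p"
        using P H(3) by (intro has_lead_divides[OF T'(2)]) (auto simp: P_def)
      then show "\<exists>p'\<in>H m. \<exists>q'\<in>lin_span K (V m) (elem m ` {j \<in> indices m. j < k}).
          p' = elem m k \<oplus>\<^bsub>V m\<^esub> q'"
        unfolding has_lead_def lower_def i(1) by blast
    qed
    with H(2) show ?thesis by blast
  qed
  ultimately show ?thesis by (intro exI[of _ G]) auto
qed

end

section \<open>Modules over the 0-Hecke category\<close>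

lemma oi_le: "xs \<in> oi n m \<Longrightarrow> n \<le> m"
  using card_mono[of "{1..m}" "set xs"] by (auto simp: oi_def strict_sorted_iff distinct_card)

lemma oi_mono: "m \<le> l \<Longrightarrow> oi n m \<subseteq> oi n l"
  by (auto simp: oi_def)

lemma oi_shuffle_word: "xs \<in> oi n m \<Longrightarrow> shuffle_word 1 xs \<in> lists {1..<m}"
  using shuffle_word_letters[of xs m 1] by (auto simp: oi_def in_lists_conv_set subset_iff)

lemma (in ring) hecke_class_hom:
  "n \<le> m \<Longrightarrow> w \<in> lists {1..<m} \<Longrightarrow> hecke_class R n m w \<in> hecke_hom R n m"
  by (simp add: hecke_hom_eq)

lemma (in module) submodule_restrict:
  assumes "submodule N R M" "submodule H R (M\<lparr>carrier := N\<rparr>)"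
  shows "submodule H R M" "H \<subseteq> N"
proof -
  interpret N: module R "M\<lparr>carrier := N\<rparr>"
    using assms(1) module_axioms by (rule submodule.submodule_is_module)
  show "H \<subseteq> N" using N.submoduleE(1)[OF assms(2)] by simp
  then have HM: "H \<subseteq> carrier M" using submoduleE(1)[OF assms(1)] by blast
  show "submodule H R M"
  proof (rule submoduleI[OF HM])
    show "\<zero>\<^bsub>M\<^esub> \<in> H" using N.submodule_zero[OF assms(2)] by simp
    show smult: "a \<odot>\<^bsub>M\<^esub> x \<in> H" if "a \<in> carrier R" "x \<in> H" for a x
      using N.submoduleE(4)[OF assms(2) that] by simp
    show "x \<oplus>\<^bsub>M\<^esub> y \<in> H" if "x \<in> H" "y \<in> H" for x y
      using N.submoduleE(5)[OF assms(2) that] by simp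
    \<comment> \<open>The inverse in the restricted structure is described over \<open>N\<close>, so
      the inverse in \<open>M\<close> is obtained as the multiple by minus one.\<close>
    show "\<ominus>\<^bsub>M\<^esub> x \<in> H" if "x \<in> H" for x
      using smult[OF R.a_inv_closed[OF R.one_closed] that] HM that by (auto simp: smult_l_minus)
  qed
qed

lemma hecke_module_act_closed:
  assumes "hecke_module K V act" "f \<in> hecke_hom K n m" "x \<in> carrier (V n)"
  shows "act n m f x \<in> carrier (V m)"
proof -
  have "act n m f \<in> linear_maps K (V n) (V m)"
    using assms(1,2) unfolding hecke_module_def by blast
  then show ?thesis using assms(3) by (auto simp: linear_maps_def)
qed

text \<open>The span of the images under injections is shown to be stable under all morphisms, hence
  everything. By \<open>oi_word_factor\<close>, acting by a word turns \<open>xs\<close> into some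
  \<open>ys\<close> followed on the source side by \<open>u\<close> and \<open>t\<close>;
  \<open>t\<close> is deleted, and \<open>u\<close> only exchanges one listed generator for
  another.\<close>

lemma hecke_module_oi_generators:
  assumes K: "field K" and V: "hecke_module K V act" and fg: "hecke_fin_gen K V act"
  defines "E \<equiv> \<lambda>gs i m xs.
    act (fst (gs ! i)) m (hecke_class K (fst (gs ! i)) m (shuffle_word 1 xs)) (snd (gs ! i))"
  shows "\<exists>gs. (\<forall>i<length gs. snd (gs ! i) \<in> carrier (V (fst (gs ! i)))) \<and>
    (\<forall>m. carrier (V m) =
      lin_span K (V m) {E gs i m xs | i xs. i < length gs \<and> xs \<in> oi (fst (gs ! i)) m})"
proof -
  interpret field K by (rule K)
  have module: "module K (V m)" for m using V by (auto simp: hecke_module_def)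
  have act: "act n m f \<in> linear_maps K (V n) (V m)" if "f \<in> hecke_hom K n m" for n m f
    using V that by (auto simp: hecke_module_def)
  have act_comp: "act m l (hecke_class K m l v) (act n m (hecke_class K n m w) x) =
      act n l (hecke_class K n l (v @ w)) x"
    if "n \<le> m" "m \<le> l" "v \<in> lists {1..<l}" "w \<in> lists {1..<m}" "x \<in> carrier (V n)" for n m l v w x
  proof -
    have "act n l (hecke_comp K n l (hecke_class K m l v) (hecke_class K n m w)) x =
        act m l (hecke_class K m l v) (act n m (hecke_class K n m w) x)"
      using V that(5) hecke_class_hom[OF that(1,4)] hecke_class_hom[OF that(2,3)]
      unfolding hecke_module_def by blast
    then show ?thesis
      by (simp only: hecke_comp_class[OF that(1-4)])
  qed
  have act_closed: "act n m (hecke_class K n m w) x \<in> carrier (V m)"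
    if "n \<le> m" "w \<in> lists {1..<m}" "x \<in> carrier (V n)" for n m w x
    by (rule hecke_module_act_closed[OF V hecke_class_hom[OF that(1,2)] that(3)])
  have act_id: "act n n (hecke_class K n n []) x = x" if "x \<in> carrier (V n)" for n x
    using V that by (auto simp: hecke_module_def hecke_id_class)
  obtain G where G: "finite G" "G \<subseteq> (SIGMA n:UNIV. carrier (V n))"
    and gen: "\<forall>N. hecke_submodule K V act N \<and> (\<forall>(n, v)\<in>G. v \<in> N n) \<longrightarrow> (\<forall>n. N n = carrier (V n))"
    using fg unfolding hecke_fin_gen_def by (elim exE conjE)
  have "\<exists>W. \<forall>n. finite (W n) \<and> W n \<subseteq> lists {1..<n} \<and>
      (\<forall>w \<in> lists {1..<n}. \<exists>v\<in>W n. word_eq True w v)"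
    by (intro choice allI finite_hecke_words)
  then obtain W where W: "\<forall>n. finite (W n) \<and> W n \<subseteq> lists {1..<n} \<and>
      (\<forall>w \<in> lists {1..<n}. \<exists>v\<in>W n. word_eq True w v)" ..
  have W_finite: "finite (W n)" and W_lists: "W n \<subseteq> lists {1..<n}" for n
    using spec[OF W, of n] by simp_all
  \<comment> \<open>All translates of the given generators by representatives of the finite monoid
    \<open>\<M>\<^sub>n\<close>; this makes the list closed under the action of words
    \<open>u\<close> on the source.\<close>
  let ?U = "(\<lambda>((n, g), v). (n, act n n (hecke_class K n n v) g)) ` (SIGMA p:G. W (fst p))"
  have "finite ?U" using G(1) W_finite by (intro finite_imageI finite_SigmaI)
  from finite_list[OF this] obtain gs where gs: "set gs = ?U" ..
  have gs_word: "\<exists>i<length gs. gs ! i = (n, act n n (hecke_class K n n w) g)"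
    if "(n, g) \<in> G" "w \<in> lists {1..<n}" for n g w
  proof -
    have "\<exists>v\<in>W n. word_eq True w v" using W that(2) by simp
    then obtain v where v: "v \<in> W n" "word_eq True w v" ..
    then have "hecke_class K n n w = hecke_class K n n v"
      using that(2) by (intro hecke_class_cong)
    moreover have "(n, act n n (hecke_class K n n v) g) \<in> ?U"
      using that(1) v(1) by force
    ultimately show ?thesis unfolding gs[symmetric] in_set_conv_nth by simp
  qed
  have gs_nth: "\<exists>n g v. (n, g) \<in> G \<and> v \<in> lists {1..<n} \<and>
      gs ! i = (n, act n n (hecke_class K n n v) g)" if "i < length gs" for i
  proof -
    have "gs ! i \<in> ?U" unfolding gs[symmetric] using that by (rule nth_mem)
    then obtain n g v where *: "(n, g) \<in> G" "v \<in> W n" "gs ! i = (n, act n n (hecke_class K n n v) g)"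
      by auto
    moreover from *(2) W_lists have "v \<in> lists {1..<n}" by (rule subsetD[rotated])
    ultimately show ?thesis by blast
  qed
  have G_closed: "g \<in> carrier (V n)" if "(n, g) \<in> G" for n g
    using G(2) that by auto
  have closed: "snd (gs ! i) \<in> carrier (V (fst (gs ! i)))" if "i < length gs" for i
  proof -
    from gs_nth[OF that] obtain n g v where g: "(n, g) \<in> G" and v: "v \<in> lists {1..<n}"
      and gi: "gs ! i = (n, act n n (hecke_class K n n v) g)" by blast
    from act_closed[OF order.refl v G_closed[OF g]] show ?thesis by (simp add: gi)
  qed
  let ?B = "\<lambda>m. {E gs i m xs | i xs. i < length gs \<and> xs \<in> oi (fst (gs ! i)) m}"
  have B: "?B m \<subseteq> carrier (V m)" for m
  proof
    fix x assume "x \<in> ?B m"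
    then obtain i xs where i: "i < length gs" and xs: "xs \<in> oi (fst (gs ! i)) m"
      and x: "x = E gs i m xs" by blast
    show "x \<in> carrier (V m)"
      unfolding x E_def by (rule act_closed[OF oi_le[OF xs] oi_shuffle_word[OF xs] closed[OF i]])
  qed
  have "hecke_submodule K V act (\<lambda>m. lin_span K (V m) (?B m))"
    unfolding hecke_submodule_def
  proof (intro conjI allI ballI)
    show "submodule (lin_span K (V m) (?B m)) K (V m)" for m
      by (rule module.lin_span_submodule[OF module B])
    fix m l f x
    assume f: "f \<in> hecke_hom K m l" and x: "x \<in> lin_span K (V m) (?B m)"
    from f obtain w where ml: "m \<le> l" and w: "w \<in> lists {1..<l}" "f = hecke_class K m l w"
      by (auto simp: hecke_hom_eq split: if_splits)
    have "act m l f b \<in> lin_span K (V l) (?B l)" if b: "b \<in> ?B m" for b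
    proof -
      from b obtain i xs where i: "i < length gs" and xs: "xs \<in> oi (fst (gs ! i)) m"
        and b: "b = E gs i m xs" by blast
      from gs_nth[OF i] obtain n g v where g: "(n, g) \<in> G" and v: "v \<in> lists {1..<n}"
        and gi: "gs ! i = (n, act n n (hecke_class K n n v) g)" by blast
      have gV: "g \<in> carrier (V n)" using g by (rule G_closed)
      have xs: "xs \<in> oi n m" using xs gi by simp
      note nm = oi_le[OF xs]
      have "xs \<in> oi n l" using xs oi_mono[OF ml] by blast
      moreover have "set w \<subseteq> {1..<l}" using w(1) by (auto simp: in_lists_conv_set)
      ultimately obtain ys u t where ys: "ys \<in> oi n l" and u: "set u \<subseteq> {1..<n}"
        and t: "set t \<subseteq> {n + 1..<l}"
        and eq: "word_eq True (w @ shuffle_word 1 xs) (shuffle_word 1 ys @ u @ t)"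
        using oi_word_factor by meson
      have uv: "u \<in> lists {1..<n}" "u @ v \<in> lists {1..<n}" "t \<in> lists {n + 1..<l}"
        using u t v by (auto simp: in_lists_conv_set)
      have ul: "u \<in> lists {1..<l}" using u nm ml by (auto simp: in_lists_conv_set)
      have wl: "w @ shuffle_word 1 xs \<in> lists {1..<l}"
        using w(1) oi_shuffle_word[OF \<open>xs \<in> oi n l\<close>] by simp
      let ?g = "act n n (hecke_class K n n v) g"
      have g': "?g \<in> carrier (V n)" using v gV by (intro act_closed) auto
      have "act m l f b = act n l (hecke_class K n l (w @ shuffle_word 1 xs)) ?g"
        using act_comp[OF nm ml w(1) oi_shuffle_word[OF xs] g'] by (simp add: b E_def gi w(2))
      also have "hecke_class K n l (w @ shuffle_word 1 xs) =
          hecke_class K n l ((shuffle_word 1 ys @ u) @ t)"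
        using hecke_class_cong[OF eq wl] by simp
      also have "\<dots> = hecke_class K n l (shuffle_word 1 ys @ u)"
        using oi_shuffle_word[OF ys] ul uv by (intro hecke_class_append) simp_all
      also have "act n l \<dots> ?g =
          act n l (hecke_class K n l (shuffle_word 1 ys)) (act n n (hecke_class K n n u) ?g)"
        using act_comp[of n n l "shuffle_word 1 ys" u ?g] oi_shuffle_word[OF ys] uv(1) g' nm ml by simp
      also have "act n n (hecke_class K n n u) ?g = act n n (hecke_class K n n (u @ v)) g"
        using act_comp[of n n n u v g] uv(1) v gV by simp
      finally have fb: "act m l f b = act n l (hecke_class K n l (shuffle_word 1 ys))
        (act n n (hecke_class K n n (u @ v)) g)" .
      from gs_word[OF g uv(2)] obtain j where "j < length gs"
        "gs ! j = (n, act n n (hecke_class K n n (u @ v)) g)" by blast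
      then have "act m l f b = E gs j l ys" "ys \<in> oi (fst (gs ! j)) l"
        using fb ys by (simp_all add: E_def)
      with \<open>j < length gs\<close> have "act m l f b \<in> ?B l" by blast
      then show ?thesis by (rule module.lin_span_base[OF module B])
    qed
    then show "act m l f x \<in> lin_span K (V l) (?B l)"
      using x by (rule lin_span_image[OF module module act[OF f] B B])
  qed
  moreover have "g \<in> lin_span K (V n) (?B n)" if g: "(n, g) \<in> G" for n g
  proof -
    have gV: "g \<in> carrier (V n)" using g by (rule G_closed)
    obtain i where i: "i < length gs" "gs ! i = (n, act n n (hecke_class K n n []) g)"
      using gs_word[OF g, of "[]"] by auto
    \<comment> \<open>\<open>[1..<Suc n]\<close> is the identity injection, whose shuffle word is
      empty.\<close>
    have "g = E gs i n [1..<Suc n]"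
      unfolding E_def i(2) shuffle_word_upt by (simp add: act_id gV)
    moreover have "[1..<Suc n] \<in> oi (fst (gs ! i)) n"
      by (auto simp: i(2) oi_def simp del: upt_Suc)
    ultimately have "g \<in> ?B n" using i(1) by blast
    then show ?thesis by (rule module.lin_span_base[OF module B])
  qed
  ultimately have "hecke_submodule K V act (\<lambda>m. lin_span K (V m) (?B m)) \<and>
      (\<forall>(n, g)\<in>G. g \<in> lin_span K (V n) (?B n))" by blast
  from gen[THEN spec, THEN mp, OF this]
  have "\<forall>n. lin_span K (V n) (?B n) = carrier (V n)" .
  with closed show ?thesis by (intro exI[of _ gs]) simp
qed

theorem theorem2p5p18:
  fixes K :: "('k, 'r) ring_scheme"
    and V :: "nat \<Rightarrow> ('k, 'v, 'p) module_scheme"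
    and act :: "nat \<Rightarrow> nat \<Rightarrow> 'k hecke_mor \<Rightarrow> 'v \<Rightarrow> 'v"
    and N :: "nat \<Rightarrow> 'v set"
  assumes "field K"
    and "hecke_module K V act"
    and "hecke_fin_gen K V act"
    and "hecke_submodule K V act N"
  shows "hecke_fin_gen K (hecke_restrict V N) act"
proof -
  interpret field K by (rule assms(1))
  \<comment> \<open>\<open>[c..<Suc m]\<close> carries the dummy strand from position
    \<open>Suc m\<close> to \<open>c\<close> and raises the positions from \<open>c\<close> to
    \<open>m\<close> by one: it is the positive lift of \<open>face c\<close>.\<close>
  define D where "D c m = act m (Suc m) (hecke_class K m (Suc m) [c..<Suc m])" for c m
  have module: "module K (V m)" for m using assms(2) by (auto simp: hecke_module_def)
  have face_hom: "hecke_class K m (Suc m) [c..<Suc m] \<in> hecke_hom K m (Suc m)"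
    if "c \<in> {1..Suc m}" for c m
    unfolding hecke_hom_eq using that by (auto simp: in_lists_conv_set simp del: upt_Suc)
  have sub: "submodule (N m) K (V m)" for m
    using assms(4) by (auto simp: hecke_submodule_def)
  obtain gs where gs: "\<And>i. i < length gs \<Longrightarrow> snd (gs ! i) \<in> carrier (V (fst (gs ! i)))"
    and span: "\<And>m. carrier (V m) = lin_span K (V m)
      {act (fst (gs ! i)) m (hecke_class K (fst (gs ! i)) m (shuffle_word 1 xs)) (snd (gs ! i)) | i xs.
        i < length gs \<and> xs \<in> oi (fst (gs ! i)) m}"
    using hecke_module_oi_generators[OF assms(1-3)] by blast
  define E where "E i m xs =
    act (fst (gs ! i)) m (hecke_class K (fst (gs ! i)) m (shuffle_word 1 xs)) (snd (gs ! i))" for i m xs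
  have hom: "hecke_class K n m (shuffle_word 1 xs) \<in> hecke_hom K n m" if "xs \<in> oi n m" for n m xs
    unfolding hecke_hom_eq using oi_le[OF that] oi_shuffle_word[OF that] by simp
  have D_E: "D c m (E i m xs) = E i (Suc m) (map (face c) xs)"
    if c: "c \<in> {1..Suc m}" and i: "i < length gs" and xs: "xs \<in> oi (fst (gs ! i)) m" for c m i xs
  proof -
    let ?n = "fst (gs ! i)"
    have w: "[c..<Suc m] \<in> lists {1..<Suc m}"
      using c by (auto simp: in_lists_conv_set simp del: upt_Suc)
    obtain t where t: "set t \<subseteq> {1 + ?n..<Suc m}"
      "word_eq True ([c..<Suc m] @ shuffle_word 1 xs) (shuffle_word 1 (map (face c) xs) @ t)"
      using shuffle_word_face[of xs 1 m c True] c xs by (auto simp: oi_def subset_iff simp del: upt_Suc)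
    have "D c m (E i m xs) = act ?n (Suc m) (hecke_comp K ?n (Suc m)
        (hecke_class K m (Suc m) [c..<Suc m]) (hecke_class K ?n m (shuffle_word 1 xs))) (snd (gs ! i))"
      using assms(2) face_hom[OF c] hom[OF xs] gs[OF i] by (simp add: hecke_module_def D_def E_def)
    also have "hecke_comp K ?n (Suc m) (hecke_class K m (Suc m) [c..<Suc m])
        (hecke_class K ?n m (shuffle_word 1 xs)) =
        hecke_class K ?n (Suc m) ([c..<Suc m] @ shuffle_word 1 xs)"
      using oi_le[OF xs] w oi_shuffle_word[OF xs] by (intro hecke_comp_class) simp_all
    also have "\<dots> = hecke_class K ?n (Suc m) (shuffle_word 1 (map (face c) xs) @ t)"
    proof (rule hecke_class_cong[OF t(2)])
      have "shuffle_word 1 xs \<in> lists {1..<Suc m}"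
        using xs oi_mono[of m "Suc m" ?n] by (intro oi_shuffle_word) auto
      with w show "[c..<Suc m] @ shuffle_word 1 xs \<in> lists {1..<Suc m}" by simp
    qed
    also have "\<dots> = hecke_class K ?n (Suc m) (shuffle_word 1 (map (face c) xs))"
      using oi_shuffle_word[OF oi_face[OF xs c]] t(1)
      by (intro hecke_class_append) (auto simp: in_lists_conv_set)
    finally show ?thesis by (simp add: E_def)
  qed
  interpret oi_module K V D "length gs" "\<lambda>i. fst (gs ! i)" E
  proof (rule oi_module.intro)
    show "D c m \<in> linear_maps K (V m) (V (Suc m))" if "c \<in> {1..Suc m}" for c m
      using assms(2) face_hom[OF that] by (simp add: hecke_module_def D_def)
    show "E i m xs \<in> carrier (V m)" if "i < length gs" "xs \<in> oi (fst (gs ! i)) m" for i m xs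
      unfolding E_def by (rule hecke_module_act_closed[OF assms(2) hom[OF that(2)] gs[OF that(1)]])
    show "carrier (V m) = lin_span K (V m) {E i m xs | i xs. i < length gs \<and> xs \<in> oi (fst (gs ! i)) m}"
      for m using span by (simp add: E_def)
  qed (use assms(1) module D_E in auto)
  have N_face: "D c m v \<in> N (Suc m)" if "c \<in> {1..Suc m}" "v \<in> N m" for c m v
    using assms(4) face_hom[OF that(1)] that(2) by (auto simp: hecke_submodule_def D_def)
  obtain G where G: "finite G" "G \<subseteq> (SIGMA m:UNIV. N m)"
    and gen: "\<And>H. \<forall>m. submodule (H m) K (V m) \<and> H m \<subseteq> N m \<Longrightarrow>
      \<forall>c m v. c \<in> {1..Suc m} \<longrightarrow> v \<in> H m \<longrightarrow> D c m v \<in> H (Suc m) \<Longrightarrow>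
      \<forall>(m, v)\<in>G. v \<in> H m \<Longrightarrow> \<forall>m. H m = N m"
    using noetherian[of N, OF sub N_face] by blast
  have "\<forall>m. H m = N m"
    if H: "hecke_submodule K (hecke_restrict V N) act H" and "\<forall>(m, v)\<in>G. v \<in> H m" for H
  proof (rule gen)
    have "submodule (H m) K ((V m)\<lparr>carrier := N m\<rparr>)" for m
      using H by (auto simp: hecke_submodule_def hecke_restrict_def)
    then show "\<forall>m. submodule (H m) K (V m) \<and> H m \<subseteq> N m"
      using module.submodule_restrict[OF module sub] by blast
    show "\<forall>c m v. c \<in> {1..Suc m} \<longrightarrow> v \<in> H m \<longrightarrow> D c m v \<in> H (Suc m)"
      using H face_hom by (auto simp: hecke_submodule_def D_def)
  qed fact
  with G show ?thesis
    unfolding hecke_fin_gen_def by (intro exI[of _ G]) (auto simp: hecke_restrict_def)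
qed

end
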